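(* The model checking problem for $\mathsf{BPL}_0$ is $\mathsf{P}$-hard (under logspace many-one reductions).
   Context: Intuitionistic formulas: $\varphi ::= \bot \mid p \mid \varphi\wedge\varphi \mid \varphi\vee\varphi \mid \varphi\Rightarrow\varphi$. A model for $\mathsf{BPL}$ is $(U,\triangleleft,\xi)$ with $U$ finite nonempty, $\triangleleft$ transitive, $\xi$ monotone ($a\in\xi(p)$, $a\triangleleft b$ imply $b\in\xi(p)$). Satisfaction: $s\not\models\bot$; $s\models p$ iff $s\in\xi(p)$; $\wedge,\vee$ pointwise; $s\models\varphi\Rightarrow\psi$ iff for all $n$ with $s\triangleleft n$, $n\models\varphi$ implies $n\models\psi$. $\mathsf{BPL}_0$ denotes the variable-free intuitionistic formulas (all connectives $\wedge,\vee,\Rightarrow,\bot$ allowed). The model checking problem: given a variable-free formula $\varphi$, a finite $\mathsf{BPL}$ model $\mathfrak{M}$ and a state $s$, decide whether $\mathfrak{M},s\models\varphi$. *)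

theory Defs
  imports Complex_Main
begin

section \<open>Basic propositional logic\<close>

datatype fm =
    Bot
  | Var nat
  | And fm fm
  | Or fm fm
  | Imp fm fm

primrec var_free :: "fm \<Rightarrow> bool" where
  "var_free Bot = True"
| "var_free (Var p) = False"
| "var_free (And \<phi> \<psi>) = (var_free \<phi> \<and> var_free \<psi>)"
| "var_free (Or \<phi> \<psi>) = (var_free \<phi> \<and> var_free \<psi>)"
| "var_free (Imp \<phi> \<psi>) = (var_free \<phi> \<and> var_free \<psi>)"

record 'w model =
  worlds :: "'w set"
  acc :: "('w \<times> 'w) set"
  valuation :: "nat \<Rightarrow> 'w set"

definition bpl_model :: "'w model \<Rightarrow> bool" where
  "bpl_model M \<longleftrightarrow>
     finite (worlds M) \<and> worlds M \<noteq> {} \<and>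
     acc M \<subseteq> worlds M \<times> worlds M \<and> trans (acc M) \<and>
     (\<forall>p. valuation M p \<subseteq> worlds M) \<and>
     (\<forall>p a b. a \<in> valuation M p \<and> (a, b) \<in> acc M \<longrightarrow> b \<in> valuation M p)"

primrec sat :: "'w model \<Rightarrow> 'w \<Rightarrow> fm \<Rightarrow> bool" where
  "sat M s Bot = False"
| "sat M s (Var p) = (s \<in> valuation M p)"
| "sat M s (And \<phi> \<psi>) = (sat M s \<phi> \<and> sat M s \<psi>)"
| "sat M s (Or \<phi> \<psi>) = (sat M s \<phi> \<or> sat M s \<psi>)"
| "sat M s (Imp \<phi> \<psi>) = (\<forall>n. (s, n) \<in> acc M \<longrightarrow> sat M n \<phi> \<longrightarrow> sat M n \<psi>)"


section \<open>Instances as bit strings\<close>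

text \<open>
  Formulas are written in Polish notation with three-bit symbols, numbers in self-delimiting
  unary.  A model is given on the worlds \<open>0, \<dots>, n - 1\<close> by the adjacency matrix of its relation
  and the characteristic vectors of the valuation of the first \<open>m\<close> variables; the remaining
  variables have empty valuation (see \<open>codes_model\<close>).
\<close>

definition enc_nat :: "nat \<Rightarrow> bool list" where
  "enc_nat n = replicate n True @ [False]"

primrec enc_fm :: "fm \<Rightarrow> bool list" where
  "enc_fm Bot = [False, False, False]"
| "enc_fm (Var p) = [False, False, True] @ enc_nat p"
| "enc_fm (And \<phi> \<psi>) = [False, True, False] @ enc_fm \<phi> @ enc_fm \<psi>"
| "enc_fm (Or \<phi> \<psi>) = [False, True, True] @ enc_fm \<phi> @ enc_fm \<psi>"
| "enc_fm (Imp \<phi> \<psi>) = [True, False, False] @ enc_fm \<phi> @ enc_fm \<psi>"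

definition enc_matrix :: "nat \<Rightarrow> nat \<Rightarrow> (nat \<Rightarrow> nat \<Rightarrow> bool) \<Rightarrow> bool list" where
  "enc_matrix k n P = concat (map (\<lambda>i. map (P i) [0..<n]) [0..<k])"

definition enc_model :: "nat \<Rightarrow> nat \<Rightarrow> nat model \<Rightarrow> bool list" where
  "enc_model n m M =
     enc_nat n @ enc_matrix n n (\<lambda>i j. (i, j) \<in> acc M) @
     enc_nat m @ enc_matrix m n (\<lambda>p i. i \<in> valuation M p)"

definition codes_model :: "nat \<Rightarrow> nat \<Rightarrow> nat model \<Rightarrow> bool" where
  "codes_model n m M \<longleftrightarrow>
     bpl_model M \<and> worlds M = {..<n} \<and> (\<forall>p\<ge>m. valuation M p = {})"

definition enc_instance :: "fm \<Rightarrow> nat \<Rightarrow> nat \<Rightarrow> nat model \<Rightarrow> nat \<Rightarrow> bool list" where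
  "enc_instance \<phi> n m M s = enc_fm \<phi> @ enc_model n m M @ enc_nat s"

definition BPL0_MC :: "bool list set" where
  "BPL0_MC =
     {enc_instance \<phi> n m M s | \<phi> n m M s.
        var_free \<phi> \<and> codes_model n m M \<and> s \<in> worlds M \<and> sat M s \<phi>}"

text \<open>The encoding is unambiguous, so \<open>BPL0_MC\<close> contains no code of a negative instance.\<close>

lemma enc_nat_cancel: "enc_nat n @ r = enc_nat n' @ r' \<Longrightarrow> n = n' \<and> r = r'"
  unfolding enc_nat_def
proof (induction n arbitrary: n')
  case 0
  then show ?case by (cases n') auto
next
  case (Suc n)
  then show ?case by (cases n') auto
qed

lemma enc_fm_cancel: "enc_fm \<phi> @ r = enc_fm \<psi> @ r' \<Longrightarrow> \<phi> = \<psi> \<and> r = r'"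
proof (induction \<phi> arbitrary: \<psi> r r')
  case Bot
  then show ?case by (cases \<psi>) auto
next
  case (Var p)
  then show ?case by (cases \<psi>) (auto dest: enc_nat_cancel)
next
  case (And \<phi>1 \<phi>2)
  from And.prems obtain \<psi>1 \<psi>2 where \<psi>: "\<psi> = And \<psi>1 \<psi>2"
    and eq: "enc_fm \<phi>1 @ enc_fm \<phi>2 @ r = enc_fm \<psi>1 @ enc_fm \<psi>2 @ r'"
    by (cases \<psi>) simp_all
  then show ?case
    using And.IH(1)[OF eq] And.IH(2)[of r _ r'] by simp
next
  case (Or \<phi>1 \<phi>2)
  from Or.prems obtain \<psi>1 \<psi>2 where \<psi>: "\<psi> = Or \<psi>1 \<psi>2"
    and eq: "enc_fm \<phi>1 @ enc_fm \<phi>2 @ r = enc_fm \<psi>1 @ enc_fm \<psi>2 @ r'"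
    by (cases \<psi>) simp_all
  then show ?case
    using Or.IH(1)[OF eq] Or.IH(2)[of r _ r'] by simp
next
  case (Imp \<phi>1 \<phi>2)
  from Imp.prems obtain \<psi>1 \<psi>2 where \<psi>: "\<psi> = Imp \<psi>1 \<psi>2"
    and eq: "enc_fm \<phi>1 @ enc_fm \<phi>2 @ r = enc_fm \<psi>1 @ enc_fm \<psi>2 @ r'"
    by (cases \<psi>) simp_all
  then show ?case
    using Imp.IH(1)[OF eq] Imp.IH(2)[of r _ r'] by simp
qed

lemma length_enc_matrix: "length (enc_matrix k n P) = k * n"
  by (induction k) (auto simp: enc_matrix_def)

lemma enc_matrix_inj:
  "enc_matrix k n P = enc_matrix k n Q \<Longrightarrow> i < k \<Longrightarrow> j < n \<Longrightarrow> P i j = Q i j"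
proof (induction k)
  case (Suc k)
  have "enc_matrix k n P = enc_matrix k n Q \<and> map (P k) [0..<n] = map (Q k) [0..<n]"
    using Suc.prems(1) by (simp add: enc_matrix_def)
  then show ?case
    using Suc.IH Suc.prems(2,3) by (cases "i = k") auto
qed simp

lemma enc_instance_inj:
  assumes eq: "enc_instance \<phi> n m M s = enc_instance \<phi>' n' m' M' s'"
    and M: "codes_model n m M" and M': "codes_model n' m' M'"
  shows "\<phi> = \<phi>' \<and> M = M' \<and> s = s'"
proof -
  have \<phi>: "\<phi> = \<phi>'" and 1: "enc_model n m M @ enc_nat s = enc_model n' m' M' @ enc_nat s'"
    using eq enc_fm_cancel unfolding enc_instance_def by blast+
  have n: "n = n'"
    using 1 enc_nat_cancel unfolding enc_model_def append_assoc by blast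
  have acc: "enc_matrix n n (\<lambda>i j. (i, j) \<in> acc M) = enc_matrix n n (\<lambda>i j. (i, j) \<in> acc M')"
    and 2: "enc_nat m @ enc_matrix m n (\<lambda>p i. i \<in> valuation M p) @ enc_nat s =
      enc_nat m' @ enc_matrix m' n (\<lambda>p i. i \<in> valuation M' p) @ enc_nat s'"
    using 1 by (auto simp: n enc_model_def length_enc_matrix)
  have m: "m = m'"
    using 2 enc_nat_cancel by blast
  have val: "enc_matrix m n (\<lambda>p i. i \<in> valuation M p) = enc_matrix m n (\<lambda>p i. i \<in> valuation M' p)"
    and 3: "enc_nat s @ [] = enc_nat s' @ []"
    using 2 by (auto simp: m length_enc_matrix)
  have "s = s'"
    using enc_nat_cancel[OF 3] by blast
  have "(i, j) \<in> acc M \<longleftrightarrow> (i, j) \<in> acc M'" for i j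
    using M M' enc_matrix_inj[OF acc, of i j] unfolding n codes_model_def bpl_model_def by blast
  then have "acc M = acc M'"
    by auto
  moreover have "i \<in> valuation M p \<longleftrightarrow> i \<in> valuation M' p" for p i
    using M M' enc_matrix_inj[OF val, of p i]
    unfolding n m codes_model_def bpl_model_def by (metis empty_iff lessThan_iff not_le subsetD)
  then have "valuation M = valuation M'"
    by auto
  ultimately have "M = M'"
    using M M' n by (simp add: codes_model_def)
  then show ?thesis
    using \<phi> \<open>s = s'\<close> by blast
qed


section \<open>Polynomial time\<close>

datatype move = Lft | Stay | Rgt

text \<open>Tapes are infinite to the right only; a left move from cell \<open>0\<close> has no effect.\<close>

primrec shift :: "move \<Rightarrow> nat \<Rightarrow> nat" where
  "shift Lft h = h - 1"
| "shift Stay h = h"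
| "shift Rgt h = h + 1"

text \<open>
  Deterministic single-tape Turing machines.  Symbol \<open>0\<close> is the blank; the input bits are
  represented by \<open>1\<close> and \<open>2\<close>.
\<close>

record tm =
  tm_states :: "nat set"
  tm_symbols :: "nat set"
  tm_start :: nat
  tm_accept :: nat
  tm_reject :: nat
  tm_delta :: "nat \<Rightarrow> nat \<Rightarrow> nat \<times> nat \<times> move"

definition wf_tm :: "tm \<Rightarrow> bool" where
  "wf_tm T \<longleftrightarrow>
     finite (tm_states T) \<and> finite (tm_symbols T) \<and> {0, 1, 2} \<subseteq> tm_symbols T \<and>
     {tm_start T, tm_accept T, tm_reject T} \<subseteq> tm_states T \<and> tm_accept T \<noteq> tm_reject T \<and>
     (\<forall>q\<in>tm_states T. \<forall>a\<in>tm_symbols T. case tm_delta T q a of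
        (q', b, d) \<Rightarrow> q' \<in> tm_states T \<and> b \<in> tm_symbols T)"

record tm_config =
  cstate :: nat
  chead :: nat
  ctape :: "nat \<Rightarrow> nat"

definition tm_init :: "tm \<Rightarrow> bool list \<Rightarrow> tm_config" where
  "tm_init T x =
     \<lparr>cstate = tm_start T, chead = 0,
      ctape = (\<lambda>i. if i < length x then (if x ! i then 2 else 1) else 0)\<rparr>"

definition tm_halted :: "tm \<Rightarrow> tm_config \<Rightarrow> bool" where
  "tm_halted T c \<longleftrightarrow> cstate c \<in> {tm_accept T, tm_reject T}"

definition tm_step :: "tm \<Rightarrow> tm_config \<Rightarrow> tm_config" where
  "tm_step T c =
     (if tm_halted T c then c
      else case tm_delta T (cstate c) (ctape c (chead c)) of
        (q, b, d) \<Rightarrow>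
          \<lparr>cstate = q, chead = shift d (chead c), ctape = (ctape c)(chead c := b)\<rparr>)"

definition tm_run :: "tm \<Rightarrow> bool list \<Rightarrow> nat \<Rightarrow> tm_config" where
  "tm_run T x t = (tm_step T ^^ t) (tm_init T x)"

definition decides_in_time :: "tm \<Rightarrow> bool list set \<Rightarrow> (nat \<Rightarrow> nat) \<Rightarrow> bool" where
  "decides_in_time T A f \<longleftrightarrow>
     (\<forall>x. tm_halted T (tm_run T x (f (length x))) \<and>
          (x \<in> A \<longleftrightarrow> cstate (tm_run T x (f (length x))) = tm_accept T))"

definition class_P :: "bool list set set" where
  "class_P = {A. \<exists>T c k. wf_tm T \<and> decides_in_time T A (\<lambda>n. c * n ^ k + c)}"


section \<open>Logarithmic-space reductions\<close>

text \<open>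
  Deterministic transducers with a two-way read-only input tape, \<open>tr_tapes\<close> work tapes and a
  write-only output to which every step appends a (possibly empty) string.  The input occupies
  the cells \<open>1, \<dots>, length x\<close> between two end markers, which the input head cannot leave: its
  position is not charged as space, so it must not serve as an unbounded counter.
\<close>

datatype input_symbol = Left_End | Bit bool | Right_End

record transducer =
  tr_states :: "nat set"
  tr_symbols :: "nat set"
  tr_tapes :: nat
  tr_start :: nat
  tr_halt :: nat
  tr_delta :: "nat \<Rightarrow> input_symbol \<Rightarrow> nat list \<Rightarrow> nat \<times> move \<times> (nat \<times> move) list \<times> bool list"

definition wf_transducer :: "transducer \<Rightarrow> bool" where
  "wf_transducer T \<longleftrightarrow>
     finite (tr_states T) \<and> finite (tr_symbols T) \<and> 0 \<in> tr_symbols T \<and>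
     {tr_start T, tr_halt T} \<subseteq> tr_states T \<and>
     (\<forall>q\<in>tr_states T. \<forall>a. \<forall>bs\<in>lists (tr_symbols T). length bs = tr_tapes T \<longrightarrow>
        (case tr_delta T q a bs of (q', d, ws, out) \<Rightarrow>
           q' \<in> tr_states T \<and> length ws = tr_tapes T \<and> fst ` set ws \<subseteq> tr_symbols T))"

text \<open>A work tape is a pair of its contents and the position of its head.\<close>

record tr_config =
  tstate :: nat
  tinput_head :: nat
  twork :: "((nat \<Rightarrow> nat) \<times> nat) list"
  toutput :: "bool list"

definition input_at :: "bool list \<Rightarrow> nat \<Rightarrow> input_symbol" where
  "input_at x i =
     (if i = 0 then Left_End else if i \<le> length x then Bit (x ! (i - 1)) else Right_End)"

definition tr_init :: "transducer \<Rightarrow> tr_config" where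
  "tr_init T =
     \<lparr>tstate = tr_start T, tinput_head = 0,
      twork = replicate (tr_tapes T) (\<lambda>_. 0, 0), toutput = []\<rparr>"

definition tr_step :: "transducer \<Rightarrow> bool list \<Rightarrow> tr_config \<Rightarrow> tr_config" where
  "tr_step T x c =
     (if tstate c = tr_halt T then c
      else case tr_delta T (tstate c) (input_at x (tinput_head c))
                  (map (\<lambda>(w, h). w h) (twork c)) of
        (q, d, ws, out) \<Rightarrow>
          \<lparr>tstate = q,
           tinput_head = min (shift d (tinput_head c)) (length x + 1),
           twork = map2 (\<lambda>(w, h) (b, e). (w(h := b), shift e h)) (twork c) ws,
           toutput = toutput c @ out\<rparr>)"

definition tr_run :: "transducer \<Rightarrow> bool list \<Rightarrow> nat \<Rightarrow> tr_config" where
  "tr_run T x t = (tr_step T x ^^ t) (tr_init T)"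

definition computes :: "transducer \<Rightarrow> (bool list \<Rightarrow> bool list) \<Rightarrow> bool" where
  "computes T f \<longleftrightarrow>
     (\<forall>x. \<exists>t. tstate (tr_run T x t) = tr_halt T \<and> toutput (tr_run T x t) = f x)"

definition runs_in_logspace :: "transducer \<Rightarrow> bool" where
  "runs_in_logspace T \<longleftrightarrow>
     (\<exists>c::real. \<forall>x t. \<forall>(w, h) \<in> set (twork (tr_run T x t)).
        real h \<le> c * log 2 (real (length x) + 2))"

definition logspace_computable :: "(bool list \<Rightarrow> bool list) \<Rightarrow> bool" where
  "logspace_computable f \<longleftrightarrow>
     (\<exists>T. wf_transducer T \<and> computes T f \<and> runs_in_logspace T)"

definition logspace_reducible :: "bool list set \<Rightarrow> bool list set \<Rightarrow> bool" where
  "logspace_reducible A B \<longleftrightarrow>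
     (\<exists>f. logspace_computable f \<and> (\<forall>x. x \<in> A \<longleftrightarrow> f x \<in> B))"

definition P_hard :: "bool list set \<Rightarrow> bool" where
  "P_hard B \<longleftrightarrow> (\<forall>A\<in>class_P. logspace_reducible A B)"

end

theory Submission
  imports Defs
begin

text \<open>
  In a finite model whose worlds are arranged in levels, with accessibility from every world to
  all worlds at least two levels below, variable-free formulas \<open>below i\<close> recognise the levels, and
  \<open>\<phi> \<Rightarrow> below i\<close> holds at a world of level \<open>i + 2\<close> iff none of its successors on the next lower
  level satisfies \<open>\<phi>\<close>.  Iterating this turns the worlds into the gates of a layered NOR circuit;
  transitivity is harmless because edges across two levels are always present.  Without reflexive
  worlds, variable-free formulas could only express the depth of a world; the inputs of the
  circuit are therefore distinguished by whether they see a reflexive world.  The computation table of a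
  polynomial-time Turing machine is such a circuit, with two levels per step.

  The adjacency matrix, the formula and the world are printed by a while program over finitely
  many counters of polynomial size; a transducer keeps the counters in binary on one work tape.
\<close>

section \<open>Machines with one work tape\<close>

text \<open>By transitivity a gate also sees whatever its inputs see, and without variables no
  formula can name a gate; so a formula must be able to ignore all successors but the direct inputs.
  As the conclusion of an implication evaluated on level i + 2, \<open>below i\<close> is true at
  all successors of level at most i, which therefore never refute the implication, and false at
  those of level i + 1. One machine step takes two rounds of NOR because cell contents are
  represented one-hot and negated: the NOR of three negated equations is a conjunction, and the NOR
  of all conjunctions that produce a given content is again a negated equation. Each formula
  contains its predecessor only once, so the final one has quadratic length in the number of levels,
  and it depends on the input only through its length. A single number N, a power of
  \<open>length x + 2\<close>, serves as the number of steps, as the last tape cell and, plus one,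
  as the bound on all counters.\<close>

type_synonym ('q, 'a) trans =
  "'q \<Rightarrow> input_symbol \<Rightarrow> 'a \<Rightarrow> 'q \<times> move \<times> 'a \<times> move \<times> bool list"

type_synonym ('q, 'a) config = "'q \<times> nat \<times> (nat \<Rightarrow> 'a) \<times> nat \<times> bool list"

fun mstep :: "('q, 'a) trans \<Rightarrow> 'q \<Rightarrow> bool list \<Rightarrow> ('q, 'a) config \<Rightarrow> ('q, 'a) config" where
  "mstep \<delta> qh x (q, i, w, h, out) =
     (if q = qh then (q, i, w, h, out)
      else case \<delta> q (input_at x i) (w h) of
        (q', d, b, e, o') \<Rightarrow>
          (q', min (shift d i) (length x + 1), w(h := b), shift e h, out @ o'))"

fun work_head :: "('q, 'a) config \<Rightarrow> nat" where
  "work_head (q, i, w, h, out) = h"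

text \<open>The bound on the work head is imposed on every configuration of the run, so that one
  derivation certifies both halting and space.\<close>

inductive reach :: "('q, 'a) trans \<Rightarrow> 'q \<Rightarrow> bool list \<Rightarrow> nat \<Rightarrow>
    ('q, 'a) config \<Rightarrow> ('q, 'a) config \<Rightarrow> bool" for \<delta> qh x H where
  refl: "work_head c \<le> H \<Longrightarrow> reach \<delta> qh x H c c"
| step: "work_head c \<le> H \<Longrightarrow> reach \<delta> qh x H (mstep \<delta> qh x c) d \<Longrightarrow> reach \<delta> qh x H c d"

lemma reach_trans: "reach \<delta> qh x H a b \<Longrightarrow> reach \<delta> qh x H b c \<Longrightarrow> reach \<delta> qh x H a c"
  by (induction rule: reach.induct) (auto intro: reach.step)

lemma reach_imp_funpow: "reach \<delta> qh x H c d \<Longrightarrow> \<exists>t. (mstep \<delta> qh x ^^ t) c = d"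
proof (induction rule: reach.induct)
  case (refl c)
  then show ?case by (intro exI[of _ 0]) simp
next
  case (step c d)
  then obtain t where "(mstep \<delta> qh x ^^ t) (mstep \<delta> qh x c) = d" by blast
  then show ?case by (intro exI[of _ "Suc t"]) (simp add: funpow_swap1)
qed

text \<open>Space is to be bounded at all times, also after halting. Since \<open>d\<close> is a
  fixed point, every iterate of \<open>c\<close> is a configuration of the derivation.\<close>

lemma reach_head_le:
  "reach \<delta> qh x H c d \<Longrightarrow> mstep \<delta> qh x d = d \<Longrightarrow> work_head ((mstep \<delta> qh x ^^ t) c) \<le> H"
proof (induction arbitrary: t rule: reach.induct)
  case (refl c)
  have "(mstep \<delta> qh x ^^ t) c = c"
    by (induction t) (simp_all add: refl.prems)
  then show ?case using refl by simp
next
  case (step c d)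
  then show ?case by (cases t) (simp_all add: funpow_swap1)
qed

text \<open>The states of a compiled program contain stacks of commands and thus come from an
  infinite type; hence the finite closed set \<open>Q\<close>. States and symbols are renamed to
  numbers.\<close>

lemma logspace_computable_machine:
  fixes \<delta> :: "('q, 'a) trans"
  assumes Q: "finite Q" "q0 \<in> Q" "qh \<in> Q" "\<And>q a b. q \<in> Q \<Longrightarrow> fst (\<delta> q a b) \<in> Q"
    and fin: "finite (UNIV :: 'a set)"
    and reach: "\<And>x. \<exists>i w h. reach \<delta> qh x (H x) (q0, 0, \<lambda>_. blank, 0, []) (qh, i, w, h, f x)"
    and H: "\<And>x. real (H x) \<le> C * log 2 (real (length x) + 2)"
  shows "logspace_computable f"
proof -
  obtain g :: "'q \<Rightarrow> nat" where g: "inj_on g Q"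
    using finite_imp_inj_to_nat_seg[OF Q(1)] by blast
  obtain e' :: "'a \<Rightarrow> nat" where e': "inj e'"
    using finite_imp_inj_to_nat_seg[OF fin] by blast
  \<comment> \<open>The tapes of a transducer start filled with 0, so \<open>blank\<close> must
    become 0 and the other codes are shifted by one to stay clear of it.\<close>
  define e where "e a = (if a = blank then 0 else Suc (e' a))" for a
  have e: "inj e" "e blank = 0"
    using e' by (auto simp: inj_def e_def)
  define T where "T = \<lparr>tr_states = g ` Q, tr_symbols = range e, tr_tapes = 1,
     tr_start = g q0, tr_halt = g qh,
     tr_delta = (\<lambda>q a bs. case \<delta> (inv_into Q g q) a (inv e (hd bs)) of
       (q', d, b, m, o') \<Rightarrow> (g q', d, [(e b, m)], o'))\<rparr>"
  define conc where "conc = (\<lambda>(q, i, w, h, out). \<lparr>tstate = g q, tinput_head = i,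
     twork = [(\<lambda>j. e (w j), h)], toutput = out\<rparr>)"
  have Q': "(q', r) = \<delta> q a b \<Longrightarrow> q \<in> Q \<Longrightarrow> q' \<in> Q" for q q' a b r
    using Q(4)[of q a b] by (metis fst_conv)
  have wf: "wf_transducer T"
    using Q e finite_imageI[OF fin, of e] unfolding wf_transducer_def T_def
    by (auto simp: g inv_into_f_f split: prod.split dest: Q'[OF sym])
  have step: "tr_step T x (conc c) = conc (mstep \<delta> qh x c)" "fst (mstep \<delta> qh x c) \<in> Q"
    if "fst c \<in> Q" for c x
    using that Q(3) g e(1)
    by (cases c; auto simp: tr_step_def conc_def T_def inj_on_eq_iff fun_upd_def
        split: prod.split dest: Q'[OF sym])+
  have run: "tr_run T x t = conc ((mstep \<delta> qh x ^^ t) (q0, 0, \<lambda>_. blank, 0, [])) \<and>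
      fst ((mstep \<delta> qh x ^^ t) (q0, 0, \<lambda>_. blank, 0, [])) \<in> Q" for x t
  proof (induction t)
    case 0
    then show ?case using Q e by (simp add: tr_run_def tr_init_def T_def conc_def)
  next
    case (Suc t)
    then show ?case using step by (simp add: tr_run_def)
  qed
  have "computes T f"
    unfolding computes_def
  proof
    fix x
    obtain t i w h where "(mstep \<delta> qh x ^^ t) (q0, 0, \<lambda>_. blank, 0, []) = (qh, i, w, h, f x)"
      using reach[of x] reach_imp_funpow by meson
    then show "\<exists>t. tstate (tr_run T x t) = tr_halt T \<and> toutput (tr_run T x t) = f x"
      using run by (intro exI[of _ t]) (simp add: conc_def T_def)
  qed
  moreover have "real h \<le> C * log 2 (real (length x) + 2)"
    if "(w, h) \<in> set (twork (tr_run T x t))" for x t w h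
  proof -
    obtain i w' h' where "reach \<delta> qh x (H x) (q0, 0, \<lambda>_. blank, 0, []) (qh, i, w', h', f x)"
      using reach by blast
    then have "work_head ((mstep \<delta> qh x ^^ t) (q0, 0, \<lambda>_. blank, 0, [])) \<le> H x"
      by (rule reach_head_le) simp
    moreover have "h = work_head ((mstep \<delta> qh x ^^ t) (q0, 0, \<lambda>_. blank, 0, []))"
      using that run[of x t] by (auto simp: conc_def split: prod.splits)
    ultimately show ?thesis using H[of x] by linarith
  qed
  ultimately show ?thesis
    using wf unfolding logspace_computable_def runs_in_logspace_def by blast
qed


section \<open>While programs over bounded counters\<close>

text \<open>The flag of \<open>Less\<close> asks for a distance of at least two. Together with the
  plain comparison it recognises neighbouring numbers without changing a counter.\<close>

datatype 'r test = Less bool 'r 'r | Inp "input_symbol set"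

datatype 'r com =
    Emit "bool list"
  | Tick 'r
  | Zero 'r
  | Rewind
  | Forward
  | Seq "'r com" "'r com"
  | Cond "'r test" "'r com" "'r com"
  | While "'r test" "'r com"

primrec holds :: "bool list \<Rightarrow> ('r \<Rightarrow> nat) \<Rightarrow> nat \<Rightarrow> 'r test \<Rightarrow> bool" where
  "holds x s h (Less k r r') = (s r + of_bool k < s r')"
| "holds x s h (Inp A) = (input_at x h \<in> A)"

text \<open>The guard of \<open>Tick\<close> keeps counters that start at most \<open>B\<close> at
  most \<open>B\<close>, which fixes how many binary digits suffice.\<close>

inductive exec :: "bool list \<Rightarrow> nat \<Rightarrow> 'r com \<Rightarrow> ('r \<Rightarrow> nat) \<Rightarrow> nat \<Rightarrow> bool list \<Rightarrow>
    ('r \<Rightarrow> nat) \<Rightarrow> nat \<Rightarrow> bool" for x B where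
  Emit: "exec x B (Emit w) s h w s h"
| Tick: "s r < B \<Longrightarrow> exec x B (Tick r) s h [] (s(r := Suc (s r))) h"
| Zero: "exec x B (Zero r) s h [] (s(r := 0)) h"
| Rewind: "exec x B Rewind s h [] s 0"
| Forward: "exec x B Forward s h [] s (min (Suc h) (length x + 1))"
| Seq: "exec x B c s h w s' h' \<Longrightarrow> exec x B d s' h' w' s'' h'' \<Longrightarrow>
    exec x B (Seq c d) s h (w @ w') s'' h''"
| Cond: "exec x B (if holds x s h t then c else d) s h w s' h' \<Longrightarrow>
    exec x B (Cond t c d) s h w s' h'"
| While: "exec x B (Cond t (Seq c (While t c)) (Emit [])) s h w s' h' \<Longrightarrow>
    exec x B (While t c) s h w s' h'"

section \<open>Compiling programs to a finite control\<close>

text \<open>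
  All counters share one tape: cell \<open>0\<close> is marked, and cell \<open>j + 1\<close> holds the set of the
  counters whose binary digit of weight \<open>2 ^ j\<close> is \<open>1\<close>.  The control consists of a phase and of
  the stack of commands that remain to be executed; a command on a counter is one sweep over the
  tape, starting at the digits of least weight, with two bits of memory.
\<close>

datatype phase = Start | Fetch | Sweep bool bool | Home bool

datatype 'r cellsym = Blank | Mark | Col "'r set"

lemma finite_UNIV_phase: "finite (UNIV :: phase set)"
proof -
  have "(UNIV :: phase set) \<subseteq> {Start, Fetch} \<union> range (\<lambda>(u, v). Sweep u v) \<union> range Home"
    by (auto simp: image_iff) (metis phase.exhaust)
  then show ?thesis
    by (rule finite_subset) simp
qed

lemma finite_UNIV_cellsym: "finite (UNIV :: 'r::finite cellsym set)"
proof -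
  have "(UNIV :: 'r cellsym set) \<subseteq> {Blank, Mark} \<union> range Col"
    by (auto simp: image_iff) (metis cellsym.exhaust)
  then show ?thesis
    by (rule finite_subset) simp
qed

fun fetch :: "'r com list \<Rightarrow> input_symbol \<Rightarrow> (phase \<times> 'r com list) \<times> move \<times> bool list" where
  "fetch [] a = ((Fetch, []), Stay, [])"
| "fetch (Emit w # K) a = ((Fetch, K), Stay, w)"
| "fetch (Tick r # K) a = ((Sweep True False, Tick r # K), Stay, [])"
| "fetch (Zero r # K) a = ((Sweep False False, Zero r # K), Stay, [])"
| "fetch (Rewind # K) a =
     (if a = Left_End then ((Fetch, K), Stay, []) else ((Fetch, Rewind # K), Lft, []))"
| "fetch (Forward # K) a = ((Fetch, K), Rgt, [])"
| "fetch (Seq c d # K) a = ((Fetch, c # d # K), Stay, [])"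
| "fetch (Cond t c d # K) a =
     (case t of
        Less k r r' \<Rightarrow> ((Sweep k False, Cond t c d # K), Stay, [])
      | Inp A \<Rightarrow> ((Fetch, (if a \<in> A then c else d) # K), Stay, []))"
| "fetch (While t c # K) a = ((Fetch, Cond t (Seq c (While t c)) (Emit []) # K), Stay, [])"

text \<open>For \<open>Tick\<close>, \<open>u\<close> is the carry. For a comparison,
  \<open>u\<close> is the carry of the left counter plus its flag, and \<open>v\<close> tells
  whether this sum is smaller on the digits read so far; a heavier digit overrides \<open>v\<close>
  unless both sides agree on it.\<close>

fun digit :: "'r com \<Rightarrow> bool \<Rightarrow> bool \<Rightarrow> 'r set \<Rightarrow> bool \<times> bool \<times> 'r set" where
  "digit (Tick r) u v c =
     (u \<and> r \<in> c, v, if u then (if r \<in> c then c - {r} else insert r c) else c)"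
| "digit (Zero r) u v c = (u, v, c - {r})"
| "digit (Cond (Less k r r') _ _) u v c =
     (u \<and> r \<in> c, if ((r \<in> c) \<noteq> u) = (r' \<in> c) then v else r' \<in> c, c)"
| "digit _ u v c = (u, v, c)"

fun overflow :: "'r com \<Rightarrow> bool \<Rightarrow> 'r cellsym" where
  "overflow (Tick r) True = Col {r}"
| "overflow _ _ = Blank"

fun resume :: "bool \<Rightarrow> 'r com list \<Rightarrow> 'r com list" where
  "resume v (Cond t c d # K) = (if v then c else d) # K"
| "resume v (_ # K) = K"
| "resume v [] = []"

definition delta :: "(phase \<times> 'r com list, 'r cellsym) trans" where
  "delta = (\<lambda>(ph, K) a b. case ph of
       Start \<Rightarrow> ((Fetch, K), Stay, Mark, Rgt, [])
     | Fetch \<Rightarrow> (case fetch K a of (q, d, w) \<Rightarrow> (q, d, b, Stay, w))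
     | Sweep u v \<Rightarrow> (case b of
         Col c \<Rightarrow> (case digit (hd K) u v c of
           (u', v', c') \<Rightarrow> ((Sweep u' v', K), Stay, Col c', Rgt, []))
       | _ \<Rightarrow> ((Home (v \<and> \<not> u), K), Stay, overflow (hd K) u, Lft, []))
     | Home v \<Rightarrow>
         if b = Mark then ((Fetch, resume v K), Stay, b, Rgt, [])
         else ((Home v, K), Stay, b, Lft, []))"

text \<open>The stacks that can occur while \<open>c\<close> runs on top of \<open>K\<close>. The
  set is finite because the body of a loop always runs on the same stack
  \<open>While t c # K\<close>, however often it is repeated.\<close>

primrec conts :: "'r com \<Rightarrow> 'r com list \<Rightarrow> 'r com list set" where
  "conts (Emit w) K = {Emit w # K}"
| "conts (Tick r) K = {Tick r # K}"
| "conts (Zero r) K = {Zero r # K}"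
| "conts Rewind K = {Rewind # K}"
| "conts Forward K = {Forward # K}"
| "conts (Seq c d) K = insert (Seq c d # K) (conts c (d # K) \<union> conts d K)"
| "conts (Cond t c d) K = insert (Cond t c d # K) (conts c K \<union> conts d K)"
| "conts (While t c) K =
     {While t c # K, Cond t (Seq c (While t c)) (Emit []) # K, Seq c (While t c) # K, Emit [] # K} \<union>
     conts c (While t c # K)"

lemma finite_conts: "finite (conts c K)"
  by (induction c arbitrary: K) auto

lemma conts_self: "c # K \<in> conts c K"
  by (cases c) auto

lemma fetch_conts:
  "L \<in> conts c K \<Longrightarrow> snd (fst (fetch L a)) \<in> insert K (conts c K)"
proof (induction c arbitrary: K)
  case (Seq c d)
  then consider "L = Seq c d # K" | "L \<in> conts c (d # K)" | "L \<in> conts d K" by auto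
  then show ?case
    by cases (use conts_self[of c "d # K"] conts_self[of d K] Seq.IH(1)[of "d # K"] Seq.IH(2)[of K] in auto)
next
  case (Cond t c d)
  then consider "L = Cond t c d # K" | "L \<in> conts c K" | "L \<in> conts d K" by auto
  then show ?case
    by cases (use conts_self[of c K] conts_self[of d K] Cond.IH in \<open>auto split: test.split\<close>)
next
  case (While t c)
  then consider "L \<in> conts (While t c) K" "L \<notin> conts c (While t c # K)"
    | "L \<in> conts c (While t c # K)" by auto
  then show ?case
    by cases (use conts_self[of c "While t c # K"] While.IH in \<open>auto split: test.split\<close>)
qed auto

lemma resume_conts:
  "L \<in> conts c K \<Longrightarrow> resume v L \<in> insert K (conts c K)"
proof (induction c arbitrary: K)
  case (Seq c d)
  then consider "L = Seq c d # K" | "L \<in> conts c (d # K)" | "L \<in> conts d K" by auto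
  then show ?case
    by cases (use conts_self[of c "d # K"] conts_self[of d K] Seq.IH(1)[of "d # K"] Seq.IH(2)[of K] in auto)
next
  case (Cond t c d)
  then consider "L = Cond t c d # K" | "L \<in> conts c K" | "L \<in> conts d K" by auto
  then show ?case
    by cases (use conts_self[of c K] conts_self[of d K] Cond.IH in auto)
next
  case (While t c)
  then consider "L \<in> conts (While t c) K" "L \<notin> conts c (While t c # K)"
    | "L \<in> conts c (While t c # K)" by auto
  then show ?case
    by cases (use conts_self[of c "While t c # K"] While.IH in auto)
qed auto

section \<open>Binary arithmetic of one sweep\<close>

primrec val :: "'r set list \<Rightarrow> 'r \<Rightarrow> nat" where
  "val [] r = 0"
| "val (c # cs) r = of_bool (r \<in> c) + 2 * val cs r"

definition tape :: "'r set list \<Rightarrow> nat \<Rightarrow> 'r cellsym" where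
  "tape cs j = (if j = 0 then Mark else if j \<le> length cs then Col (cs ! (j - 1)) else Blank)"

primrec digits :: "'r com \<Rightarrow> bool \<Rightarrow> bool \<Rightarrow> 'r set list \<Rightarrow> bool \<times> bool \<times> 'r set list" where
  "digits c u v [] = (u, v, [])"
| "digits c u v (x # xs) =
     (case digit c u v x of (u', v', x') \<Rightarrow>
        case digits c u' v' xs of (u'', v'', xs') \<Rightarrow> (u'', v'', x' # xs'))"

lemma val_append: "val (cs @ ds) r = val cs r + 2 ^ length cs * val ds r"
  by (induction cs) (simp_all add: algebra_simps)

lemma length_digits: "digits c u v cs = (u', v', cs') \<Longrightarrow> length cs' = length cs"
  by (induction cs arbitrary: u v cs') (auto split: prod.splits)

lemma digits_Tick:
  "digits (Tick r) u v cs = (u', v', cs') \<Longrightarrow>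
     val cs' r + of_bool u' * 2 ^ length cs = val cs r + of_bool u \<and> (\<forall>r'. r' \<noteq> r \<longrightarrow> val cs' r' = val cs r')"
proof (induction cs arbitrary: u v cs')
  case (Cons y ys)
  then obtain ys' where "digits (Tick r) (u \<and> r \<in> y) v ys = (u', v', ys')"
    and "cs' = (if u then (if r \<in> y then y - {r} else insert r y) else y) # ys'"
    by (auto split: prod.splits)
  with Cons.IH[of "u \<and> r \<in> y" v ys'] show ?case
    by (cases u; cases "r \<in> y") auto
qed simp

lemma digits_Zero:
  "digits (Zero r) u v cs = (u', v', cs') \<Longrightarrow> val cs' = (val cs)(r := 0)"
proof (induction cs arbitrary: u v cs')
  case (Cons y ys)
  then obtain ys' where "digits (Zero r) u v ys = (u', v', ys')" and "cs' = (y - {r}) # ys'"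
    by (auto split: prod.splits)
  with Cons.IH[of u v ys'] show ?case
    by (auto simp: fun_eq_iff)
qed (simp add: fun_eq_iff)

text \<open>A carry left after the last digit makes the sum too large for the right counter, whence
  the outcome \<open>v' \<and> \<not> u'\<close>. The disjunct with \<open>v\<close> carries the
  induction: the verdict on the lighter digits decides exactly when the remaining ones tie.\<close>

lemma digits_Less:
  "digits (Cond (Less k r r') c d) u v cs = (u', v', cs') \<Longrightarrow>
     cs' = cs \<and> (v' \<and> \<not> u' \<longleftrightarrow>
       val cs r + of_bool u < val cs r' \<or> val cs r + of_bool u = val cs r' \<and> v)"
proof (induction cs arbitrary: u v cs')
  case (Cons y ys)
  define v1 where "v1 = (if ((r \<in> y) \<noteq> u) = (r' \<in> y) then v else r' \<in> y)"
  from Cons.prems obtain ys'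
    where d: "digits (Cond (Less k r r') c d) (u \<and> r \<in> y) v1 ys = (u', v', ys')"
      and cs': "cs' = y # ys'"
    by (auto split: prod.splits simp: v1_def)
  define a b where "a = val ys r" and "b = val ys r'"
  have "ys' = ys" and "v' \<and> \<not> u' \<longleftrightarrow> a + of_bool (u \<and> r \<in> y) < b \<or>
      a + of_bool (u \<and> r \<in> y) = b \<and> v1"
    using Cons.IH[OF d] by (auto simp: a_def b_def)
  note this(2)
  also have "a + of_bool (u \<and> r \<in> y) < b \<or> a + of_bool (u \<and> r \<in> y) = b \<and> v1 \<longleftrightarrow>
      of_bool (r \<in> y) + 2 * a + of_bool u < of_bool (r' \<in> y) + 2 * b \<or>
      of_bool (r \<in> y) + 2 * a + of_bool u = of_bool (r' \<in> y) + 2 * b \<and> v"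
    unfolding v1_def by (cases u; cases "r \<in> y"; cases "r' \<in> y"; simp; arith)
  finally show ?case
    using cs' \<open>ys' = ys\<close> by (simp add: a_def b_def)
qed auto

section \<open>Simulating an execution by sweeps\<close>

lemma delta_simps:
  "delta (Start, K) a b = ((Fetch, K), Stay, Mark, Rgt, [])"
  "delta (Fetch, K) a b = (case fetch K a of (q, d, w) \<Rightarrow> (q, d, b, Stay, w))"
  "delta (Sweep u v, K) a (Col c) =
     (case digit (hd K) u v c of (u', v', c') \<Rightarrow> ((Sweep u' v', K), Stay, Col c', Rgt, []))"
  "delta (Sweep u v, K) a Blank =
     ((Home (v \<and> \<not> u), K), Stay, overflow (hd K) u, Lft, [])"
  "delta (Home v, K) a b =
     (if b = Mark then ((Fetch, resume v K), Stay, b, Rgt, []) else ((Home v, K), Stay, b, Lft, []))"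
  by (simp_all add: delta_def)

lemma mstep_delta:
  "q \<noteq> (Fetch, []) \<Longrightarrow> mstep delta (Fetch, []) x (q, i, w, h, out) =
     (case delta q (input_at x i) (w h) of (q', d, b, e, o') \<Rightarrow>
        (q', min (shift d i) (length x + 1), w(h := b), shift e h, out @ o'))"
  by simp

lemma tape_simps:
  "tape cs 0 = Mark"
  "tape (pre @ y # ys) (Suc (length pre)) = Col y"
  "(tape (pre @ y # ys))(Suc (length pre) := Col z) = tape (pre @ z # ys)"
  "tape cs (Suc (length cs)) = Blank"
  "(tape cs)(Suc (length cs) := Col z) = tape (cs @ [z])"
  by (auto simp: tape_def fun_eq_iff nth_append nth_Cons')

lemma reach_sweep:
  assumes "i \<le> length x + 1"
  shows "digits c u v xs = (u', v', xs') \<Longrightarrow> length pre + length xs < H \<Longrightarrow>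
    reach delta (Fetch, []) x H ((Sweep u v, c # K), i, tape (pre @ xs), Suc (length pre), out)
      ((Sweep u' v', c # K), i, tape (pre @ xs'), Suc (length pre + length xs), out)"
proof (induction xs arbitrary: pre u v xs')
  case Nil
  then show ?case by (auto intro: reach.refl)
next
  case (Cons y ys)
  obtain u1 v1 y' where y: "digit c u v y = (u1, v1, y')"
    by (cases "digit c u v y")
  with Cons.prems obtain ys' where ys: "digits c u1 v1 ys = (u', v', ys')" and xs': "xs' = y' # ys'"
    by (auto split: prod.splits)
  have "mstep delta (Fetch, []) x ((Sweep u v, c # K), i, tape (pre @ y # ys), Suc (length pre), out) =
      ((Sweep u1 v1, c # K), i, tape ((pre @ [y']) @ ys), Suc (length (pre @ [y'])), out)"
    using assms y by (simp add: mstep_delta delta_simps tape_simps del: mstep.simps)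
  then show ?case
    using Cons.IH[OF ys, of "pre @ [y']"] Cons.prems(2) xs'
    by - (rule reach.step, auto simp del: mstep.simps)
qed

lemma reach_home:
  assumes "i \<le> length x + 1"
  shows "j \<le> length cs \<Longrightarrow> length cs < H \<Longrightarrow>
    reach delta (Fetch, []) x H ((Home v, K), i, tape cs, j, out)
      ((Fetch, resume v K), i, tape cs, Suc 0, out)"
proof (induction j)
  case 0
  have "mstep delta (Fetch, []) x ((Home v, K), i, tape cs, 0, out) =
      ((Fetch, resume v K), i, tape cs, Suc 0, out)"
    using assms by (auto simp: mstep_delta delta_simps tape_def simp del: mstep.simps)
  then show ?case
    using 0 by - (rule reach.step, auto intro: reach.refl simp del: mstep.simps)
next
  case (Suc j)
  have "mstep delta (Fetch, []) x ((Home v, K), i, tape cs, Suc j, out) =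
      ((Home v, K), i, tape cs, j, out)"
    using assms Suc.prems by (auto simp: mstep_delta delta_simps tape_def simp del: mstep.simps)
  then show ?case
    using Suc by - (rule reach.step, auto simp del: mstep.simps)
qed

text \<open>A sweep ends on the cell behind the last column, which receives a new column exactly if
  an increment overflows; this is why \<open>ds\<close> has two cases. The verdict of a test is
  formed there as well, once the final carry is known.\<close>

lemma reach_counter_command:
  assumes i: "i \<le> length x + 1" and cs: "length cs < H"
    and digits: "digits c u v cs = (u', v', cs')"
    and ds: "overflow c u' = Blank \<and> ds = cs' \<or> overflow c u' = Col z \<and> ds = cs' @ [z]" "length ds < H"
  shows "reach delta (Fetch, []) x H ((Sweep u v, c # K), i, tape cs, Suc 0, out)
      ((Fetch, resume (v' \<and> \<not> u') (c # K)), i, tape ds, Suc 0, out)"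
proof -
  have len: "length cs' = length cs"
    using length_digits[OF digits] .
  have "mstep delta (Fetch, []) x ((Sweep u' v', c # K), i, tape cs', Suc (length cs), out) =
      ((Home (v' \<and> \<not> u'), c # K), i, tape ds, length cs, out)"
    using i ds unfolding len[symmetric]
    by (auto simp: mstep_delta delta_simps tape_simps simp del: mstep.simps)
  moreover have "reach delta (Fetch, []) x H ((Home (v' \<and> \<not> u'), c # K), i, tape ds, length cs, out)
      ((Fetch, resume (v' \<and> \<not> u') (c # K)), i, tape ds, Suc 0, out)"
    using ds len by (intro reach_home[OF i]) auto
  ultimately have "reach delta (Fetch, []) x H ((Sweep u' v', c # K), i, tape cs', Suc (length cs), out)
      ((Fetch, resume (v' \<and> \<not> u') (c # K)), i, tape ds, Suc 0, out)"
    using cs by - (rule reach.step, auto simp del: mstep.simps)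
  then show ?thesis
    using reach_sweep[OF i digits, of "[]" H K out] cs by (auto intro: reach_trans)
qed

lemma reach_fetch:
  assumes "i \<le> length x + 1" "0 < H"
    "reach delta (Fetch, []) x H (case fetch (c # K) (input_at x i) of (q, d, w) \<Rightarrow>
        (q, min (shift d i) (length x + 1), tape cs, Suc 0, out @ w)) e"
  shows "reach delta (Fetch, []) x H ((Fetch, c # K), i, tape cs, Suc 0, out) e"
proof -
  have "mstep delta (Fetch, []) x ((Fetch, c # K), i, tape cs, Suc 0, out) =
      (case fetch (c # K) (input_at x i) of (q, d, w) \<Rightarrow>
        (q, min (shift d i) (length x + 1), tape cs, Suc 0, out @ w))"
    by (simp add: mstep_delta delta_simps del: mstep.simps split: prod.split)
  then show ?thesis
    using assms by - (rule reach.step, auto simp del: mstep.simps)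
qed

lemma input_at_Left_End: "input_at x i = Left_End \<longleftrightarrow> i = 0"
  by (simp add: input_at_def)

text \<open>The invariant is that \<open>W\<close> columns suffice. Only a carry out of a
  \<open>Tick\<close> adds a column, and then the new counter value is at least
  \<open>2 ^ length cs\<close> but at most \<open>B < 2 ^ W\<close>, so a column is still
  free.\<close>

lemma exec_reach:
  "exec x B c s h w s' h' \<Longrightarrow> B < 2 ^ W \<Longrightarrow> val cs = s \<Longrightarrow> length cs \<le> W \<Longrightarrow> h \<le> length x + 1 \<Longrightarrow>
   \<exists>cs'. val cs' = s' \<and> length cs' \<le> W \<and> h' \<le> length x + 1 \<and>
     reach delta (Fetch, []) x (Suc W) ((Fetch, c # K), h, tape cs, Suc 0, out)
       ((Fetch, K), h', tape cs', Suc 0, out @ w)"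
proof (induction arbitrary: cs K out rule: exec.induct)
  case (Emit w s h)
  then show ?case
    by (intro exI[of _ cs] conjI reach_fetch) (auto intro: reach.refl)
next
  case (Tick s r h)
  obtain u' v' cs' where d: "digits (Tick r) True False cs = (u', v', cs')"
    by (cases "digits (Tick r) True False cs")
  note len = length_digits[OF d]
  define ds where "ds = (if u' then cs' @ [{r}] else cs')"
  have v: "val cs' r + of_bool u' * 2 ^ length cs = Suc (s r)" "r' \<noteq> r \<Longrightarrow> val cs' r' = s r'" for r'
    using digits_Tick[OF d] Tick.prems by auto
  have "val ds = s(r := Suc (s r))"
    using v by (auto simp: ds_def val_append len fun_eq_iff)
  moreover have "u' \<Longrightarrow> length cs < W"
  proof -
    assume u'
    then have "2 ^ length cs \<le> B"
      using v(1) Tick.hyps by simp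
    then have "(2::nat) ^ length cs < 2 ^ W"
      using Tick.prems(1) by linarith
    then show "length cs < W" by simp
  qed
  then have "length ds \<le> W"
    using Tick.prems len by (auto simp: ds_def)
  moreover have "reach delta (Fetch, []) x (Suc W) ((Sweep True False, Tick r # K), h, tape cs, Suc 0, out)
      ((Fetch, resume (v' \<and> \<not> u') (Tick r # K)), h, tape ds, Suc 0, out)"
    using Tick.prems calculation
    by (intro reach_counter_command[OF _ _ d, where z = "{r}"]) (auto simp: ds_def)
  ultimately show ?case
    using Tick.prems by (intro exI[of _ ds] conjI reach_fetch) auto
next
  case (Zero r s h)
  obtain u' v' cs' where d: "digits (Zero r) False False cs = (u', v', cs')"
    by (cases "digits (Zero r) False False cs")
  have "reach delta (Fetch, []) x (Suc W) ((Sweep False False, Zero r # K), h, tape cs, Suc 0, out)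
      ((Fetch, resume (v' \<and> \<not> u') (Zero r # K)), h, tape cs', Suc 0, out)"
    using Zero.prems length_digits[OF d]
    by (intro reach_counter_command[OF _ _ d]) auto
  then show ?case
    using Zero.prems digits_Zero[OF d] length_digits[OF d]
    by (intro exI[of _ cs'] conjI reach_fetch) auto
next
  case (Rewind s h)
  have "h \<le> length x + 1 \<Longrightarrow> reach delta (Fetch, []) x (Suc W) ((Fetch, Rewind # K), h, tape cs, Suc 0, out)
      ((Fetch, K), 0, tape cs, Suc 0, out)" for h
  proof (induction h)
    case 0
    then show ?case
      by (intro reach_fetch) (auto intro: reach.refl simp: input_at_Left_End)
  next
    case (Suc h)
    then show ?case
      by (intro reach_fetch) (auto simp: input_at_Left_End min_def)
  qed
  then show ?case
    using Rewind.prems by (intro exI[of _ cs]) auto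
next
  case (Forward s h)
  then show ?case
    by (intro exI[of _ cs] conjI reach_fetch) (auto intro: reach.refl simp: min.commute)
next
  case (Seq c s h w s' h' d w' s'' h'')
  obtain cs1 where 1: "val cs1 = s'" "length cs1 \<le> W" "h' \<le> length x + 1"
    "reach delta (Fetch, []) x (Suc W) ((Fetch, c # d # K), h, tape cs, Suc 0, out)
       ((Fetch, d # K), h', tape cs1, Suc 0, out @ w)"
    using Seq.IH(1) Seq.prems by blast
  obtain cs2 where 2: "val cs2 = s''" "length cs2 \<le> W" "h'' \<le> length x + 1"
    "reach delta (Fetch, []) x (Suc W) ((Fetch, d # K), h', tape cs1, Suc 0, out @ w)
       ((Fetch, K), h'', tape cs2, Suc 0, (out @ w) @ w')"
    using Seq.IH(2) Seq.prems(1) 1 by blast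
  have "reach delta (Fetch, []) x (Suc W) ((Fetch, Seq c d # K), h, tape cs, Suc 0, out)
       ((Fetch, K), h'', tape cs2, Suc 0, (out @ w) @ w')"
    using Seq.prems reach_trans[OF 1(4) 2(4)] by (intro reach_fetch) auto
  then show ?case
    using 2 by auto
next
  case (Cond s h t c d w s' h')
  obtain cs' where cs': "val cs' = s'" "length cs' \<le> W" "h' \<le> length x + 1"
    "reach delta (Fetch, []) x (Suc W)
       ((Fetch, (if holds x s h t then c else d) # K), h, tape cs, Suc 0, out)
       ((Fetch, K), h', tape cs', Suc 0, out @ w)"
    using Cond.IH Cond.prems by blast
  have r: "reach delta (Fetch, []) x (Suc W) ((Fetch, Cond t c d # K), h, tape cs, Suc 0, out)
      ((Fetch, (if holds x s h t then c else d) # K), h, tape cs, Suc 0, out)"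
  proof (cases t)
    case (Inp A)
    then show ?thesis
      using Cond.prems by (intro reach_fetch) (auto intro: reach.refl)
  next
    case (Less k r r')
    obtain u' v' ds where d: "digits (Cond t c d) k False cs = (u', v', ds)"
      by (cases "digits (Cond t c d) k False cs")
    note l = digits_Less[OF d[unfolded Less]]
    have "reach delta (Fetch, []) x (Suc W) ((Sweep k False, Cond t c d # K), h, tape cs, Suc 0, out)
        ((Fetch, resume (v' \<and> \<not> u') (Cond t c d # K)), h, tape cs, Suc 0, out)"
      using Cond.prems l by (intro reach_counter_command[OF _ _ d]) auto
    moreover have "v' \<and> \<not> u' \<longleftrightarrow> holds x s h t"
      using l Cond.prems Less by auto
    ultimately show ?thesis
      using Cond.prems Less by (intro reach_fetch) auto
  qed
  then show ?case
    using cs'(1-3) reach_trans[OF r cs'(4)] by blast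
next
  case (While t c s h w s' h')
  obtain cs' where "val cs' = s'" "length cs' \<le> W" "h' \<le> length x + 1"
    "reach delta (Fetch, []) x (Suc W)
       ((Fetch, Cond t (Seq c (While t c)) (Emit []) # K), h, tape cs, Suc 0, out)
       ((Fetch, K), h', tape cs', Suc 0, out @ w)"
    using While.IH While.prems by blast
  then show ?case
    using While.prems by (intro exI[of _ cs'] conjI reach_fetch) auto
qed

lemma fst_delta:
  assumes "K \<in> insert [] (conts c [])"
  shows "snd (fst (delta (ph, K) a b)) \<in> insert [] (conts c [])"
proof -
  have fetch: "snd (fst (fetch K a)) \<in> insert [] (conts c [])"
    using assms fetch_conts[of K c "[]"] by auto
  have resume: "resume v K \<in> insert [] (conts c [])" for v
    using assms resume_conts[of K c "[]"] by auto
  show ?thesis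
  proof (cases ph)
    case (Home v)
    then show ?thesis using assms resume[of v] by (simp add: delta_def)
  qed (use assms fetch in \<open>auto simp: delta_def split: prod.splits cellsym.splits\<close>)
qed

lemma logspace_computable_exec:
  fixes c :: "'r::finite com"
  assumes "\<And>x. \<exists>s h. exec x ((length x + 2) ^ k + 1) c (\<lambda>_. 0) 0 (f x) s h"
  shows "logspace_computable f"
proof -
  define L where "L x = nat \<lceil>log 2 (real (length x) + 2)\<rceil>" for x :: "bool list"
  have L: "real (L x) \<le> 2 * log 2 (real (length x) + 2)" "length x + 2 \<le> 2 ^ L x"
    "1 \<le> log 2 (real (length x) + 2)" for x
  proof -
    show 1: "1 \<le> log 2 (real (length x) + 2)"
      using log_mono[of 2 2 "real (length x) + 2"] by simp
    then show "real (L x) \<le> 2 * log 2 (real (length x) + 2)"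
      unfolding L_def by linarith
    have "log 2 (real (length x) + 2) \<le> real (L x)"
      unfolding L_def by linarith
    then have "real (length x) + 2 \<le> 2 powr real (L x)"
      by (subst (asm) log_le_iff) auto
    then have "real (length x + 2) \<le> real (2 ^ L x)"
      by (simp add: powr_realpow)
    then show "length x + 2 \<le> 2 ^ L x"
      by (simp only: of_nat_le_iff)
  qed
  \<comment> \<open>\<open>k * L x\<close> digits reach \<open>(length x + 2) ^ k\<close>, and two
    more leave room for the added 1. The logarithm is at least 1, so rounding and additive constants
    go into its factor.\<close>
  define W where "W x = k * L x + 2" for x
  have B: "(length x + 2) ^ k + 1 < 2 ^ W x" for x
  proof -
    have "(length x + 2) ^ k \<le> 2 ^ (k * L x)"
      using power_mono[OF L(2), of x k] by (simp add: power_mult[symmetric] mult.commute)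
    moreover have "(0::nat) < 2 ^ (k * L x)" by simp
    moreover have "(2::nat) ^ W x = 4 * 2 ^ (k * L x)" by (simp add: W_def power_add)
    ultimately show ?thesis by linarith
  qed
  have *: "(\<lambda>_. Blank)(0 := Mark) = tape ([] :: 'r set list)"
    by (auto simp: tape_def fun_eq_iff)
  have r: "\<exists>i w h. reach delta (Fetch, []) x (Suc (W x)) ((Start, [c]), 0, \<lambda>_. Blank, 0, [])
      ((Fetch, []), i, w, h, f x)" for x
  proof -
    obtain s h where "exec x ((length x + 2) ^ k + 1) c (\<lambda>_. 0) 0 (f x) s h"
      using assms by blast
    from exec_reach[OF this B, of "[]" "[]" "[]"]
    obtain cs where "reach delta (Fetch, []) x (Suc (W x)) ((Fetch, [c]), 0, tape [], Suc 0, [])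
        ((Fetch, []), h, tape cs, Suc 0, f x)"
      by (auto simp: fun_eq_iff)
    then have "reach delta (Fetch, []) x (Suc (W x)) ((Start, [c]), 0, \<lambda>_. Blank, 0, [])
        ((Fetch, []), h, tape cs, Suc 0, f x)"
      by - (rule reach.step, simp_all add: delta_simps *)
    then show ?thesis by blast
  qed
  show ?thesis
  proof (rule logspace_computable_machine[where Q = "UNIV \<times> insert [] (conts c [])",
        OF _ _ _ _ finite_UNIV_cellsym r])
    fix x
    have "real (Suc (W x)) = real k * real (L x) + 3"
      by (simp add: W_def)
    also have "\<dots> \<le> real k * (2 * log 2 (real (length x) + 2)) + 3 * log 2 (real (length x) + 2)"
      using L(3)[of x] by (intro add_mono mult_left_mono L) auto
    finally show "real (Suc (W x)) \<le> (2 * real k + 3) * log 2 (real (length x) + 2)"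
      by (simp add: algebra_simps)
  next
    show "fst (delta q a b) \<in> UNIV \<times> insert [] (conts c [])"
      if "q \<in> UNIV \<times> insert [] (conts c [])" for q a and b :: "'r cellsym"
      using that fst_delta[of "snd q" c "fst q" a b] by (auto simp: mem_Times_iff)
  qed (use conts_self[of c "[]"] in \<open>auto simp: finite_UNIV_phase finite_conts\<close>)
qed

section \<open>NOR circuits as models\<close>

definition verum :: fm where
  "verum = Imp Bot Bot"

text \<open>\<open>Imp verum \<phi>\<close> is a box, so \<open>Imp verum Bot\<close> holds exactly
  at endpoints. The formula separates level 0, where a world sees nothing or only itself, from the
  higher levels, all of whose worlds see an endpoint.\<close>

definition no_endpoint :: fm where
  "no_endpoint = Imp (Imp verum Bot) Bot"

primrec below :: "nat \<Rightarrow> fm" where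
  "below 0 = no_endpoint"
| "below (Suc i) = Imp verum (below i)"

definition all_endpoints :: fm where
  "all_endpoints = Imp verum (Imp verum Bot)"

text \<open>\<open>nor_fm i\<close> is meant for worlds of level i + 1. On level 1 it says that no
  reflexive world is seen, which is how input bits enter.\<close>

primrec nor_fm :: "nat \<Rightarrow> fm" where
  "nor_fm 0 = all_endpoints"
| "nor_fm (Suc i) = Imp (nor_fm i) (below i)"

lemma var_free_below: "var_free (below i)"
  by (induction i) (simp_all add: no_endpoint_def verum_def)

lemma var_free_nor_fm: "var_free (nor_fm i)"
  by (induction i) (simp_all add: all_endpoints_def verum_def var_free_below)

text \<open>The last two conditions make \<open>below\<close> exact: an endpoint refutes
  \<open>below 0\<close> on every positive level, and a successor on the adjacent level makes the
  later formulas fail as soon as the level exceeds the index.\<close>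

definition layered :: "'w model \<Rightarrow> ('w \<Rightarrow> nat) \<Rightarrow> bool" where
  "layered M lev \<longleftrightarrow> acc M \<subseteq> worlds M \<times> worlds M \<and>
     (\<forall>w v. (w, v) \<in> acc M \<longrightarrow> lev v < lev w \<or> lev w = 0 \<and> v = w) \<and>
     (\<forall>w\<in>worlds M. 1 \<le> lev w \<longrightarrow> (\<exists>v. (w, v) \<in> acc M \<and> (\<forall>u. (v, u) \<notin> acc M))) \<and>
     (\<forall>w\<in>worlds M. 2 \<le> lev w \<longrightarrow> (\<exists>v. (w, v) \<in> acc M \<and> Suc (lev v) = lev w))"

lemma layeredD:
  assumes "layered M lev"
  shows "(w, v) \<in> acc M \<Longrightarrow> v \<in> worlds M"
    and "(w, v) \<in> acc M \<Longrightarrow> lev v < lev w \<or> lev w = 0 \<and> v = w"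
    and "w \<in> worlds M \<Longrightarrow> 1 \<le> lev w \<Longrightarrow> \<exists>v. (w, v) \<in> acc M \<and> (\<forall>u. (v, u) \<notin> acc M)"
    and "w \<in> worlds M \<Longrightarrow> 2 \<le> lev w \<Longrightarrow> \<exists>v. (w, v) \<in> acc M \<and> Suc (lev v) = lev w"
  using assms unfolding layered_def by blast+

lemma sat_below:
  assumes "layered M lev" "w \<in> worlds M"
  shows "sat M w (below i) \<longleftrightarrow> lev w \<le> i"
  using assms(2)
proof (induction i arbitrary: w)
  case 0
  show ?case
    using layeredD(3)[OF assms(1) 0] layeredD(2)[OF assms(1), of w]
    by (cases "lev w = 0") (auto simp: no_endpoint_def verum_def)
next
  case (Suc i)
  have *: "sat M w (below (Suc i)) \<longleftrightarrow> (\<forall>v. (w, v) \<in> acc M \<longrightarrow> lev v \<le> i)"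
    using Suc.IH layeredD(1)[OF assms(1)] by (auto simp: verum_def)
  show ?case
  proof (cases "lev w \<le> Suc i")
    case True
    then show ?thesis
      using layeredD(2)[OF assms(1), of w] unfolding * by fastforce
  next
    case False
    then obtain v where "(w, v) \<in> acc M" "Suc (lev v) = lev w"
      using layeredD(4)[OF assms(1) Suc.prems] by auto
    then show ?thesis
      using False unfolding * by fastforce
  qed
qed

lemma sat_nor_fm_0:
  "sat M w (nor_fm 0) \<longleftrightarrow> (\<forall>v. (w, v) \<in> acc M \<longrightarrow> (\<forall>u. (v, u) \<notin> acc M))"
  by (auto simp: all_endpoints_def verum_def)

lemma sat_nor_fm_Suc:
  assumes "layered M lev" "lev w = Suc (Suc i)"
  shows "sat M w (nor_fm (Suc i)) \<longleftrightarrow>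
    \<not> (\<exists>v. (w, v) \<in> acc M \<and> lev v = Suc i \<and> sat M v (nor_fm i))"
proof -
  have "sat M v (below i) \<longleftrightarrow> lev v \<noteq> Suc i" if "(w, v) \<in> acc M" for v
  proof -
    have "v \<in> worlds M" "lev v < lev w"
      using layeredD(1,2)[OF assms(1) that] assms(2) by auto
    then show ?thesis
      using sat_below[OF assms(1)] assms(2) by auto
  qed
  then show ?thesis by auto
qed

text \<open>Truth of variable-free formulas is invariant under bounded morphisms. An isomorphism
  would be too strict, since the enumeration of the circuit may list a node more than once.\<close>

lemma sat_bounded_morphism:
  assumes "\<And>u v. (u, v) \<in> acc M \<Longrightarrow> (h u, h v) \<in> acc M'"
    and "\<And>u v'. u \<in> worlds M \<Longrightarrow> (h u, v') \<in> acc M' \<Longrightarrow> \<exists>v. (u, v) \<in> acc M \<and> h v = v'"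
    and "acc M \<subseteq> worlds M \<times> worlds M"
  shows "var_free \<phi> \<Longrightarrow> u \<in> worlds M \<Longrightarrow> sat M u \<phi> \<longleftrightarrow> sat M' (h u) \<phi>"
proof (induction \<phi> arbitrary: u)
  case (Imp \<phi> \<psi>)
  have "(u, v) \<in> acc M \<Longrightarrow> v \<in> worlds M" for v
    using assms(3) by blast
  then show ?case
    using Imp assms(1) assms(2)[OF Imp.prems(2)] by (auto; metis)
qed auto

section \<open>The computation of a Turing machine as a NOR circuit\<close>

type_synonym cell = "nat option \<times> nat"

definition cell_at :: "tm_config \<Rightarrow> nat \<Rightarrow> cell" where
  "cell_at c i = (if i = chead c then Some (cstate c) else None, ctape c i)"

definition leaving :: "tm \<Rightarrow> cell \<Rightarrow> move \<Rightarrow> nat option" where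
  "leaving T c m = (case fst c of
     None \<Rightarrow> None
   | Some q \<Rightarrow> if q \<in> {tm_accept T, tm_reject T} then None
       else case tm_delta T q (snd c) of (q', b, m') \<Rightarrow> if m' = m then Some q' else None)"

text \<open>
  Cell \<open>0\<close> is its own left neighbour, so the head is on two neighbouring cells \<open>b = c\<close> only if
  it is on cell \<open>0\<close>, where a left move has no effect.
\<close>

definition next_cell :: "tm \<Rightarrow> cell \<Rightarrow> cell \<Rightarrow> cell \<Rightarrow> cell" where
  "next_cell T b c d = (case fst c of
     None \<Rightarrow> (case leaving T b Rgt of None \<Rightarrow> leaving T d Lft | Some q \<Rightarrow> Some q, snd c)
   | Some q \<Rightarrow> if q \<in> {tm_accept T, tm_reject T} then c
       else case tm_delta T q (snd c) of (q', a, m) \<Rightarrow>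
         (if m = Stay \<or> m = Lft \<and> b = c then Some q' else None, a))"

text \<open>The strip of cells 0 to N is closed off by making cell N its own right neighbour. While
  the head is left of N, nothing can enter from there.\<close>

lemma cell_at_step:
  assumes "i \<le> N" "chead c < N"
  shows "cell_at (tm_step T c) i =
    next_cell T (cell_at c (i - 1)) (cell_at c i) (cell_at c (min (Suc i) N))"
proof (cases "tm_halted T c")
  case True
  then show ?thesis
    by (auto simp: tm_step_def next_cell_def cell_at_def leaving_def tm_halted_def)
next
  case False
  obtain q a m where d: "tm_delta T (cstate c) (ctape c (chead c)) = (q, a, m)"
    using prod_cases3 by blast
  consider "i = chead c" | "i = Suc (chead c)" | "Suc i = chead c" | "i \<noteq> chead c" "i \<noteq> Suc (chead c)" "Suc i \<noteq> chead c"
    by blast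
  then show ?thesis
    by cases (use False assms d in \<open>cases m; auto simp: tm_step_def next_cell_def cell_at_def
      leaving_def tm_halted_def min_def split: option.splits\<close>)+
qed

lemma chead_run: "chead (tm_run T x t) \<le> t"
proof (induction t)
  case 0
  then show ?case by (simp add: tm_run_def tm_init_def)
next
  case (Suc t)
  have "shift d h \<le> Suc h" for d h
    by (cases d) auto
  then have "chead (tm_step T c) \<le> Suc (chead c)" for c
    by (auto simp: tm_step_def split: prod.split)
  then show ?case
    using Suc by (simp add: tm_run_def) (meson le_trans Suc_le_mono)
qed

definition cells :: "tm \<Rightarrow> cell set" where
  "cells T = insert None (Some ` tm_states T) \<times> tm_symbols T"

lemma cell_at_run_in_cells:
  assumes "wf_tm T"
  shows "cell_at (tm_run T x t) i \<in> cells T"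
proof -
  have "cstate (tm_run T x t) \<in> tm_states T \<and> (\<forall>i. ctape (tm_run T x t) i \<in> tm_symbols T)"
  proof (induction t)
    case 0
    then show ?case using assms by (auto simp: tm_run_def tm_init_def wf_tm_def)
  next
    case (Suc t)
    define c where "c = tm_run T x t"
    obtain q a m where d: "tm_delta T (cstate c) (ctape c (chead c)) = (q, a, m)"
      using prod_cases3 by blast
    have "cstate c \<in> tm_states T" "\<forall>i. ctape c i \<in> tm_symbols T"
      using Suc by (auto simp: c_def)
    moreover from this have "q \<in> tm_states T" "a \<in> tm_symbols T"
      using assms d unfolding wf_tm_def by (auto split: prod.splits) (metis (no_types, lifting) d prod.case case_prodD)+
    moreover have "tm_run T x (Suc t) = tm_step T c"
      by (simp add: tm_run_def c_def)
    ultimately show ?case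
      using d by (auto simp: tm_step_def)
  qed
  then show ?thesis
    by (auto simp: cells_def cell_at_def)
qed

text \<open>
  The gate \<open>(p, i, NotC a)\<close> on level \<open>2 * p + 1\<close> computes that the cell \<open>i\<close> differs from \<open>a\<close> at
  time \<open>p\<close>, and \<open>(p + 1, i, And3 b c d)\<close> on level \<open>2 * p + 2\<close> computes that \<open>b\<close>, \<open>c\<close>, \<open>d\<close> are
  the contents of the cell \<open>i\<close> and its neighbours at time \<open>p\<close>.  The gate \<open>Flse\<close> yields false; it
  provides every gate with an input on the preceding level, and on level \<open>0\<close> it is the reflexive
  world that makes the inputs of the circuit false.  \<open>Top\<close> checks that the state is not rejecting.
\<close>

datatype gate = And3 cell cell cell | Flse | NotC cell | Top

text \<open>The indices enter only through booleans, so the wiring is a finite table that a fixed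
  program can print. Nodes at least two levels apart are always wired downwards; apart from loops on
  level 0, there is a choice only between adjacent levels.\<close>

fun wire :: "tm \<Rightarrow> cell \<Rightarrow> bool \<Rightarrow> bool \<Rightarrow> bool \<Rightarrow> bool \<Rightarrow> bool \<Rightarrow> bool \<Rightarrow> bool \<Rightarrow>
    gate \<Rightarrow> gate \<Rightarrow> bool" where
  "wire T c0 far prev same first left here right (And3 b c d) g \<longleftrightarrow> far \<or> prev \<and>
     (case g of NotC a \<Rightarrow> left \<and> a = b \<or> here \<and> a = c \<or> right \<and> a = d | Top \<Rightarrow> False | _ \<Rightarrow> True)"
| "wire T c0 far prev same first left here right Flse g \<longleftrightarrow>
     far \<or> prev \<or> same \<and> first \<and> here \<and> g = Flse"
| "wire T c0 far prev same first left here right (NotC a) g \<longleftrightarrow> far \<or> prev \<or> same \<and>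
     (case g of And3 b c d \<Rightarrow> first \<or> here \<and> next_cell T b c d = a
      | Flse \<Rightarrow> first \<longrightarrow> c0 = a | _ \<Rightarrow> False)"
| "wire T c0 far prev same first left here right Top g \<longleftrightarrow> far \<or> prev \<or> same \<and>
     (case g of And3 b c d \<Rightarrow> first \<or> fst (next_cell T b c d) = Some (tm_reject T)
      | Flse \<Rightarrow> True | _ \<Rightarrow> False)"

type_synonym node = "nat \<times> nat \<times> gate"

definition edge :: "tm \<Rightarrow> bool list \<Rightarrow> nat \<Rightarrow> node \<Rightarrow> node \<Rightarrow> bool" where
  "edge T x N = (\<lambda>(p, i, g) (p', i', g').
     wire T (cell_at (tm_init T x) i) (Suc p' < p) (Suc p' = p) (p' = p) (p = 0)
       (i' = i - 1) (i' = i) (i' = min (Suc i) N) g g')"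

fun level :: "node \<Rightarrow> nat" where
  "level (p, i, And3 b c d) = 2 * p"
| "level (p, i, Flse) = 2 * p"
| "level (p, i, NotC a) = Suc (2 * p)"
| "level (p, i, Top) = Suc (2 * p)"

definition gates :: "tm \<Rightarrow> gate set" where
  "gates T = {Top, Flse} \<union> NotC ` cells T \<union> (\<lambda>(b, c, d). And3 b c d) ` (cells T \<times> cells T \<times> cells T)"

lemma in_gates:
  "Top \<in> gates T" "Flse \<in> gates T" "NotC a \<in> gates T \<longleftrightarrow> a \<in> cells T"
  "And3 b c d \<in> gates T \<longleftrightarrow> b \<in> cells T \<and> c \<in> cells T \<and> d \<in> cells T"
  by (auto simp: gates_def image_iff)

definition circuit :: "tm \<Rightarrow> bool list \<Rightarrow> nat \<Rightarrow> node model" where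
  "circuit T x N = \<lparr>worlds = {..N} \<times> {..N} \<times> gates T,
     acc = {(w, v). w \<in> {..N} \<times> {..N} \<times> gates T \<and> v \<in> {..N} \<times> {..N} \<times> gates T \<and> edge T x N w v},
     valuation = (\<lambda>_. {})\<rparr>"

lemma acc_circuit:
  "((p, i, g), (p', i', g')) \<in> acc (circuit T x N) \<longleftrightarrow>
     p \<le> N \<and> i \<le> N \<and> g \<in> gates T \<and> p' \<le> N \<and> i' \<le> N \<and> g' \<in> gates T \<and>
     wire T (cell_at (tm_init T x) i) (Suc p' < p) (Suc p' = p) (p' = p) (p = 0)
       (i' = i - 1) (i' = i) (i' = min (Suc i) N) g g'"
  by (auto simp: circuit_def edge_def)

section \<open>The circuit is transitive and layered\<close>

lemma level_less_if_edge:
  "edge T x N w v \<Longrightarrow> level v < level w \<or> level w = 0 \<and> v = w"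
  by (cases w rule: level.cases; cases v rule: level.cases) (auto simp: edge_def)

lemma edge_if_level_less:
  "Suc (level v) < level w \<Longrightarrow> edge T x N w v"
  by (cases w rule: level.cases; cases v rule: level.cases) (auto simp: edge_def)

text \<open>Two descending edges drop at least two levels, where every edge exists. If one of the
  two is a loop on level 0, the other is already the required edge.\<close>

lemma trans_edge: "edge T x N w v \<Longrightarrow> edge T x N v u \<Longrightarrow> edge T x N w u"
  using level_less_if_edge[of T x N w v] level_less_if_edge[of T x N v u]
    edge_if_level_less[of u w T x N] by fastforce

lemma layered_circuit:
  assumes "wf_tm T"
  shows "layered (circuit T x N) level"
proof -
  obtain b where b: "b \<in> cells T"
    using cell_at_run_in_cells[OF assms] by blast
  have "\<exists>v. (w, v) \<in> acc (circuit T x N) \<and> (\<forall>u. (v, u) \<notin> acc (circuit T x N))"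
    if "w \<in> worlds (circuit T x N)" "1 \<le> level w" for w
  proof -
    \<comment> \<open>The gates \<open>And3\<close> of time 0 are endpoints, and every world of
      positive level sees all of them; any content \<open>b\<close> will do.\<close>
    have "(w, (0, 0, And3 b b b)) \<in> acc (circuit T x N)"
      using that b by (cases w rule: level.cases) (auto simp: acc_circuit in_gates circuit_def edge_def)
    moreover have "((0, 0, And3 b b b), u) \<notin> acc (circuit T x N)" for u
      by (cases u) (auto simp: acc_circuit)
    ultimately show ?thesis by blast
  qed
  moreover have "\<exists>v. (w, v) \<in> acc (circuit T x N) \<and> Suc (level v) = level w"
    if w: "w \<in> worlds (circuit T x N)" "2 \<le> level w" for w
  proof (cases w rule: level.cases)
    case (1 p i b c d)
    then show ?thesis
      using w by (intro exI[of _ "(p - 1, i - 1, NotC b)"]) (auto simp: acc_circuit in_gates circuit_def edge_def)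
  next
    case (2 p i)
    then show ?thesis
      using w b by (intro exI[of _ "(p - 1, i, NotC b)"]) (auto simp: acc_circuit in_gates circuit_def edge_def)
  next
    case (3 p i a)
    then show ?thesis
      using w by (intro exI[of _ "(p, i, Flse)"]) (auto simp: acc_circuit in_gates circuit_def edge_def)
  next
    case (4 p i)
    then show ?thesis
      using w by (intro exI[of _ "(p, i, Flse)"]) (auto simp: acc_circuit in_gates circuit_def edge_def)
  qed
  moreover have "(w, v) \<in> acc (circuit T x N) \<longrightarrow> level v < level w \<or> level w = 0 \<and> v = w" for w v
    using level_less_if_edge[of T x N w v] by (auto simp: circuit_def)
  ultimately show ?thesis
    unfolding layered_def by (auto simp: circuit_def)
qed

lemma ex_level_odd:
  "(\<exists>v. (w, v) \<in> acc (circuit T x N) \<and> level v = Suc (2 * t) \<and> P v) \<longleftrightarrow>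
     (\<exists>i g. (w, (t, i, g)) \<in> acc (circuit T x N) \<and> (g = Top \<or> (\<exists>a. g = NotC a)) \<and> P (t, i, g))"
  (is "?L \<longleftrightarrow> ?R")
proof
  assume ?L
  then obtain p i g where v: "(w, (p, i, g)) \<in> acc (circuit T x N)" "level (p, i, g) = Suc (2 * t)" "P (p, i, g)"
    by (metis prod_cases3)
  then have "p = t \<and> (g = Top \<or> (\<exists>a. g = NotC a))"
    by (cases g; simp; presburger)
  then show ?R using v by blast
next
  assume ?R
  then obtain i g where "(w, (t, i, g)) \<in> acc (circuit T x N)" "g = Top \<or> (\<exists>a. g = NotC a)" "P (t, i, g)"
    by blast
  then show ?L by (intro exI[of _ "(t, i, g)"]) auto
qed

lemma ex_level_even:
  "(\<exists>v. (w, v) \<in> acc (circuit T x N) \<and> level v = Suc (Suc (2 * t)) \<and> P v) \<longleftrightarrow>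
     (\<exists>i g. (w, (Suc t, i, g)) \<in> acc (circuit T x N) \<and> (g = Flse \<or> (\<exists>b c d. g = And3 b c d)) \<and>
       P (Suc t, i, g))"
  (is "?L \<longleftrightarrow> ?R")
proof
  assume ?L
  then obtain p i g where v: "(w, (p, i, g)) \<in> acc (circuit T x N)"
    "level (p, i, g) = Suc (Suc (2 * t))" "P (p, i, g)"
    by (metis prod_cases3)
  then have "p = Suc t \<and> (g = Flse \<or> (\<exists>b c d. g = And3 b c d))"
    by (cases g; simp; presburger)
  then show ?R using v by blast
next
  assume ?R
  then obtain i g where "(w, (Suc t, i, g)) \<in> acc (circuit T x N)" "g = Flse \<or> (\<exists>b c d. g = And3 b c d)" "P (Suc t, i, g)"
    by blast
  then show ?L by (intro exI[of _ "(Suc t, i, g)"]) auto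
qed

section \<open>Values of the gates, by induction on time\<close>

context
  fixes T :: tm and x :: "bool list" and N :: nat
  assumes T: "wf_tm T"
begin

abbreviation cell_time :: "nat \<Rightarrow> nat \<Rightarrow> cell" where
  "cell_time t i \<equiv> cell_at (tm_run T x t) i"

lemma sat_And3:
  assumes "t < N" "i \<le> N" "b \<in> cells T" "c \<in> cells T" "d \<in> cells T"
    and IH: "\<And>i a. i \<le> N \<Longrightarrow> a \<in> cells T \<Longrightarrow>
      sat (circuit T x N) (t, i, NotC a) (nor_fm (2 * t)) \<longleftrightarrow> cell_time t i \<noteq> a"
  shows "sat (circuit T x N) (Suc t, i, And3 b c d) (nor_fm (Suc (2 * t))) \<longleftrightarrow>
    cell_time t (i - 1) = b \<and> cell_time t i = c \<and> cell_time t (min (Suc i) N) = d"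
proof -
  have "sat (circuit T x N) (Suc t, i, And3 b c d) (nor_fm (Suc (2 * t))) \<longleftrightarrow>
    \<not> (\<exists>j g. ((Suc t, i, And3 b c d), (t, j, g)) \<in> acc (circuit T x N) \<and>
       (g = Top \<or> (\<exists>a. g = NotC a)) \<and> sat (circuit T x N) (t, j, g) (nor_fm (2 * t)))"
    by (subst sat_nor_fm_Suc[OF layered_circuit[OF T]]) (auto simp only: ex_level_odd level.simps mult_Suc_right add_2_eq_Suc)
  also have "\<dots> \<longleftrightarrow> \<not> (\<exists>j a. j \<le> N \<and> a \<in> cells T \<and>
      (j = i - 1 \<and> a = b \<or> j = i \<and> a = c \<or> j = min (Suc i) N \<and> a = d) \<and> cell_time t j \<noteq> a)"
  proof -
    have acc: "((Suc t, i, And3 b c d), (t, j, g)) \<in> acc (circuit T x N) \<longleftrightarrow>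
        j \<le> N \<and> (\<exists>a\<in>cells T. g = NotC a \<and>
          (j = i - 1 \<and> a = b \<or> j = i \<and> a = c \<or> j = min (Suc i) N \<and> a = d))"
      if "g = Top \<or> (\<exists>a. g = NotC a)" for j g
    proof (cases g)
      case (NotC a)
      then show ?thesis using assms(1-5) by (simp add: acc_circuit in_gates)
    qed (use that in \<open>simp_all add: acc_circuit\<close>)
    show ?thesis (is "\<not> ?L \<longleftrightarrow> \<not> ?R")
    proof (intro arg_cong[where f = Not] iffI)
      assume ?L
      then obtain j g where g: "((Suc t, i, And3 b c d), (t, j, g)) \<in> acc (circuit T x N)"
        "g = Top \<or> (\<exists>a. g = NotC a)" "sat (circuit T x N) (t, j, g) (nor_fm (2 * t))"
        by blast
      then obtain a where a: "j \<le> N" "a \<in> cells T" "g = NotC a"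
        "j = i - 1 \<and> a = b \<or> j = i \<and> a = c \<or> j = min (Suc i) N \<and> a = d"
        using acc[OF g(2)] by blast
      then have "cell_time t j \<noteq> a"
        using g(3) IH by simp
      then show ?R using a by blast
    next
      assume ?R
      then obtain j a where a: "j \<le> N" "a \<in> cells T" "cell_time t j \<noteq> a"
        "j = i - 1 \<and> a = b \<or> j = i \<and> a = c \<or> j = min (Suc i) N \<and> a = d"
        by blast
      have "((Suc t, i, And3 b c d), (t, j, NotC a)) \<in> acc (circuit T x N)"
        using acc[of "NotC a" j] a by blast
      moreover have "sat (circuit T x N) (t, j, NotC a) (nor_fm (2 * t))"
        using IH a by simp
      ultimately show ?L by blast
    qed
  qed
  also have "\<dots> \<longleftrightarrow>
      cell_time t (i - 1) = b \<and> cell_time t i = c \<and> cell_time t (min (Suc i) N) = d"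
  proof -
    have "i - 1 \<le> N" "min (Suc i) N \<le> N"
      using assms(2) by auto
    then show ?thesis
      using assms(2-5) by blast
  qed
  finally show ?thesis .
qed

text \<open>All gates \<open>NotC a\<close> of the preceding time are inputs of \<open>Flse\<close>.
  There are at least two possible contents and a cell has only one, so some input is true.\<close>

lemma sat_Flse:
  assumes "t < N" "i \<le> N"
    and IH: "\<And>i a. i \<le> N \<Longrightarrow> a \<in> cells T \<Longrightarrow>
      sat (circuit T x N) (t, i, NotC a) (nor_fm (2 * t)) \<longleftrightarrow> cell_time t i \<noteq> a"
  shows "\<not> sat (circuit T x N) (Suc t, i, Flse) (nor_fm (Suc (2 * t)))"
proof -
  have "(None, 0) \<in> cells T" "(None, 1) \<in> cells T"
    using T by (auto simp: cells_def wf_tm_def)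
  then obtain a where a: "a \<in> cells T" "cell_time t i \<noteq> a"
    by (metis prod.inject zero_neq_one)
  have "((Suc t, i, Flse), (t, i, NotC a)) \<in> acc (circuit T x N)"
    using assms a by (auto simp: acc_circuit in_gates)
  moreover have "sat (circuit T x N) (t, i, NotC a) (nor_fm (2 * t))"
    using a IH assms by simp
  moreover have "level (t, i, NotC a) = Suc (2 * t)"
    by simp
  ultimately show ?thesis
    using sat_nor_fm_Suc[OF layered_circuit[OF T], of "(Suc t, i, Flse)" "2 * t" x N]
    by (metis level.simps(2) mult_Suc_right add_2_eq_Suc)
qed

text \<open>At each position exactly one gate \<open>And3\<close> is true, the one with the actual
  contents, and \<open>Flse\<close> contributes nothing. The NOR over all triples thus only asks
  whether one of these true gates is wired to \<open>g\<close>; this covers both \<open>NotC\<close>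
  and \<open>Top\<close>.\<close>

lemma sat_after:
  assumes "t < N" "level (Suc t, i, g) = Suc (Suc (Suc (2 * t)))"
    and IH: "\<And>i a. i \<le> N \<Longrightarrow> a \<in> cells T \<Longrightarrow>
      sat (circuit T x N) (t, i, NotC a) (nor_fm (2 * t)) \<longleftrightarrow> cell_time t i \<noteq> a"
  shows "sat (circuit T x N) (Suc t, i, g) (nor_fm (2 * Suc t)) \<longleftrightarrow>
    \<not> (\<exists>j. ((Suc t, i, g), (Suc t, j, And3 (cell_time t (j - 1)) (cell_time t j)
        (cell_time t (min (Suc j) N)))) \<in> acc (circuit T x N))"
proof -
  have Flse: "\<not> sat (circuit T x N) (Suc t, j, Flse) (nor_fm (Suc (2 * t)))"
    if "((Suc t, i, g), (Suc t, j, Flse)) \<in> acc (circuit T x N)" for j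
    using that by (intro sat_Flse[OF assms(1) _ IH]) (simp_all add: acc_circuit)
  have And3: "sat (circuit T x N) (Suc t, j, And3 b c d) (nor_fm (Suc (2 * t))) \<longleftrightarrow>
      cell_time t (j - 1) = b \<and> cell_time t j = c \<and> cell_time t (min (Suc j) N) = d"
    if "((Suc t, i, g), (Suc t, j, And3 b c d)) \<in> acc (circuit T x N)" for j b c d
    using that by (intro sat_And3[OF assms(1) _ _ _ _ IH]) (simp_all add: acc_circuit in_gates)
  have "sat (circuit T x N) (Suc t, i, g) (nor_fm (Suc (Suc (2 * t)))) \<longleftrightarrow>
    \<not> (\<exists>j h. ((Suc t, i, g), (Suc t, j, h)) \<in> acc (circuit T x N) \<and>
       (h = Flse \<or> (\<exists>b c d. h = And3 b c d)) \<and> sat (circuit T x N) (Suc t, j, h) (nor_fm (Suc (2 * t))))"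
    by (subst sat_nor_fm_Suc[OF layered_circuit[OF T] assms(2)]) (simp only: ex_level_even)
  also have "\<dots> \<longleftrightarrow> \<not> (\<exists>j b c d. ((Suc t, i, g), (Suc t, j, And3 b c d)) \<in> acc (circuit T x N) \<and>
      sat (circuit T x N) (Suc t, j, And3 b c d) (nor_fm (Suc (2 * t))))"
    using Flse by blast
  also have "\<dots> \<longleftrightarrow> \<not> (\<exists>j b c d. ((Suc t, i, g), (Suc t, j, And3 b c d)) \<in> acc (circuit T x N) \<and>
      cell_time t (j - 1) = b \<and> cell_time t j = c \<and> cell_time t (min (Suc j) N) = d)"
    by (simp only: And3 cong: conj_cong)
  finally show ?thesis
    by (simp only: mult_Suc_right add_2_eq_Suc) blast
qed

lemma next_cell_time:
  assumes "t < N" "i \<le> N"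
  shows "next_cell T (cell_time t (i - 1)) (cell_time t i) (cell_time t (min (Suc i) N)) =
    cell_time (Suc t) i"
  using cell_at_step[of i N "tm_run T x t" T] chead_run[of T x t] assms by (simp add: tm_run_def)

text \<open>At time 0 the successors are gates \<open>And3\<close>, which are endpoints, and,
  exactly if the initial content is \<open>a\<close>, the reflexive gates
  \<open>Flse\<close>.\<close>

lemma sat_NotC:
  "t \<le> N \<Longrightarrow> i \<le> N \<Longrightarrow> a \<in> cells T \<Longrightarrow>
     sat (circuit T x N) (t, i, NotC a) (nor_fm (2 * t)) \<longleftrightarrow> cell_time t i \<noteq> a"
proof (induction t arbitrary: i a)
  case 0
  have Flse: "((0, j, Flse), (0, j, Flse)) \<in> acc (circuit T x N)" if "j \<le> N" for j
    using that by (simp add: acc_circuit in_gates)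
  have And3: "((0, j, And3 b c d), v) \<notin> acc (circuit T x N)" for j b c d v
    by (cases v) (simp add: acc_circuit)
  have acc: "((0, i, NotC a), (p, j, g)) \<in> acc (circuit T x N) \<longleftrightarrow> p = 0 \<and> j \<le> N \<and> g \<in> gates T \<and>
      ((\<exists>b c d. g = And3 b c d) \<or> g = Flse \<and> cell_time 0 i = a)" for p j g
    using 0 by (cases g) (auto simp: acc_circuit in_gates tm_run_def)
  have "sat (circuit T x N) (0, i, NotC a) (nor_fm 0) \<longleftrightarrow>
      \<not> (\<exists>p j g u. ((0, i, NotC a), (p, j, g)) \<in> acc (circuit T x N) \<and> ((p, j, g), u) \<in> acc (circuit T x N))"
    unfolding sat_nor_fm_0 by auto
  also have "\<dots> \<longleftrightarrow> cell_time 0 i \<noteq> a"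
  proof (cases "cell_time 0 i = a")
    case True
    then have "((0, i, NotC a), (0, i, Flse)) \<in> acc (circuit T x N)"
      using \<open>i \<le> N\<close> acc by (simp add: in_gates)
    then show ?thesis
      using True Flse[OF \<open>i \<le> N\<close>] by blast
  next
    case False
    have "((p, j, g), u) \<notin> acc (circuit T x N)"
      if succ: "((0, i, NotC a), (p, j, g)) \<in> acc (circuit T x N)" for p j g u
    proof -
      obtain b c d where "g = And3 b c d" "p = 0"
        using succ False unfolding acc by blast
      then show ?thesis using And3 by simp
    qed
    then show ?thesis using False by blast
  qed
  finally show ?case by simp
next
  case (Suc t)
  have "sat (circuit T x N) (Suc t, i, NotC a) (nor_fm (2 * Suc t)) \<longleftrightarrow>
    \<not> (\<exists>j. ((Suc t, i, NotC a), (Suc t, j, And3 (cell_time t (j - 1)) (cell_time t j)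
        (cell_time t (min (Suc j) N)))) \<in> acc (circuit T x N))"
    using Suc by (intro sat_after) auto
  also have "\<dots> \<longleftrightarrow> cell_time (Suc t) i \<noteq> a"
    using Suc.prems next_cell_time[of t i] cell_at_run_in_cells[OF T]
    by (auto simp: acc_circuit in_gates)
  finally show ?case .
qed

text \<open>The head position is not fixed in advance, so \<open>Top\<close> reads all positions; at
  time N the head is still on one of them. N must be positive because the gates read at time N
  combine contents of time N - 1.\<close>

lemma sat_Top:
  assumes "0 < N"
  shows "sat (circuit T x N) (N, 0, Top) (nor_fm (2 * N)) \<longleftrightarrow>
    cstate (tm_run T x N) \<noteq> tm_reject T"
proof -
  obtain t where N: "N = Suc t"
    using assms gr0_implies_Suc by blast
  have "sat (circuit T x N) (Suc t, 0, Top) (nor_fm (2 * Suc t)) \<longleftrightarrow>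
    \<not> (\<exists>j. ((Suc t, 0, Top), (Suc t, j, And3 (cell_time t (j - 1)) (cell_time t j)
        (cell_time t (min (Suc j) N)))) \<in> acc (circuit T x N))"
    using N sat_NotC[of t] by (intro sat_after) auto
  also have "\<dots> \<longleftrightarrow> \<not> (\<exists>j\<le>N. fst (cell_time N j) = Some (tm_reject T))"
    using N next_cell_time[of t] cell_at_run_in_cells[OF T]
    by (auto simp: acc_circuit in_gates simp del: min_Suc_Suc)
  also have "\<dots> \<longleftrightarrow> cstate (tm_run T x N) \<noteq> tm_reject T"
    using chead_run[of T x N] by (auto simp: cell_at_def)
  finally show ?thesis
    using N by simp
qed

end

section \<open>Printing the instance\<close>

text \<open>Resetting the counter makes it available to later loops, each of which relies on
  starting from 0.\<close>

definition for_loop :: "'r \<Rightarrow> 'r \<Rightarrow> 'r com \<Rightarrow> 'r com" where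
  "for_loop r m c = Seq (While (Less False r m) (Seq c (Tick r))) (Zero r)"

lemma exec_for_loop:
  assumes "r \<noteq> m" "M \<le> B" "S 0 r = 0" "\<And>v. v \<le> M \<Longrightarrow> S v m = M"
    and body: "\<And>v. v < M \<Longrightarrow>
      exec x B c ((S v)(r := v)) (H v) (w v) ((S (Suc v))(r := v)) (H (Suc v))"
  shows "exec x B (for_loop r m c) (S 0) (H 0) (concat (map w [0..<M])) ((S M)(r := 0)) (H M)"
proof -
  have "exec x B (While (Less False r m) (Seq c (Tick r))) ((S v)(r := v)) (H v)
      (concat (map w [v..<M])) ((S M)(r := M)) (H M)" if "v \<le> M" for v
    using that
  proof (induction rule: inc_induct)
    case base
    show ?case
      using assms by (auto intro!: exec.While exec.Cond intro: exec.Emit)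
  next
    case (step v)
    have "exec x B (Seq c (Tick r)) ((S v)(r := v)) (H v) (w v @ []) ((S (Suc v))(r := Suc v)) (H (Suc v))"
      using exec.Tick[of "(S (Suc v))(r := v)" r B x "H (Suc v)"] step(2) assms(2)
      by (intro exec.Seq[OF body]) auto
    then have "exec x B (Seq (Seq c (Tick r)) (While (Less False r m) (Seq c (Tick r)))) ((S v)(r := v)) (H v)
        ((w v @ []) @ concat (map w [Suc v..<M])) ((S M)(r := M)) (H M)"
      using step.IH by (rule exec.Seq)
    moreover have "holds x ((S v)(r := v)) (H v) (Less False r m)"
      using step(2) assms(1,4) by simp
    ultimately have "exec x B (While (Less False r m) (Seq c (Tick r))) ((S v)(r := v)) (H v)
        ((w v @ []) @ concat (map w [Suc v..<M])) ((S M)(r := M)) (H M)"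
      by (intro exec.While exec.Cond) (simp only: if_True)
    then show ?case
      using step(2) by (simp add: upt_conv_Cons fun_upd_def)
  qed
  from exec.Seq[OF this[of 0] exec.Zero[where r = r]] show ?thesis
    using assms(3) by (simp add: for_loop_def fun_upd_idem)
qed

lemma exec_for_loop_const:
  assumes "r \<noteq> m" "s m \<le> B" "s r = 0"
    and "\<And>v. v < s m \<Longrightarrow> exec x B c (s(r := v)) (H v) (w v) (s(r := v)) (H (Suc v))"
  shows "exec x B (for_loop r m c) s (H 0) (concat (map w [0..<s m])) s (H (s m))"
  using exec_for_loop[of r m "s m" B "\<lambda>_. s" x c H w] assms by (simp add: fun_upd_idem)

lemma exec_for_loop_const_head:
  assumes "r \<noteq> m" "s m \<le> B" "s r = 0"
    and "\<And>v. v < s m \<Longrightarrow> exec x B c (s(r := v)) h (w v) (s(r := v)) h"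
  shows "exec x B (for_loop r m c) s h (concat (map w [0..<s m])) s h"
  using exec_for_loop_const[of r m s B x c "\<lambda>_. h" w] assms by simp

lemma concat_map_Nil: "concat (map (\<lambda>_. []) xs) = []"
  by (induction xs) auto

lemma exec_for_loop_tick:
  assumes "r \<noteq> m" "y \<noteq> r" "y \<noteq> m" "s y + s m \<le> B" "s r = 0"
  shows "exec x B (for_loop r m (Tick y)) s h [] (s(y := s y + s m)) h"
proof -
  have "exec x B (Tick y) (s(y := s y + v, r := v)) h [] (s(y := s y + Suc v, r := v)) h"
    if "v < s m" for v
    using exec.Tick[of "s(y := s y + v, r := v)" y B x h] that assms by (simp add: fun_upd_twist)
  then have "exec x B (for_loop r m (Tick y)) (s(y := s y + 0)) h (concat (map (\<lambda>_. []) [0..<s m]))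
      (s(y := s y + s m, r := 0)) h"
    using assms
    by (intro exec_for_loop[where S = "\<lambda>v. s(y := s y + v)" and H = "\<lambda>_. h"]) auto
  then show ?thesis
    using assms by (simp add: concat_map_Nil fun_upd_idem fun_upd_twist)
qed

text \<open>\<open>Null\<close> is never incremented and serves as the constant 0 in comparisons.
  The row and column counters index the matrix; earlier they are loop counters and scratch
  space.\<close>

datatype reg = Len | Num | Suc_Num | Row_Time | Row_Pos | Col_Time | Col_Pos | Null

instance reg :: finite
proof
  have "(UNIV :: reg set) = {Len, Num, Suc_Num, Row_Time, Row_Pos, Col_Time, Col_Pos, Null}"
    by (auto intro: reg.exhaust)
  then show "finite (UNIV :: reg set)"
    by (metis finite.emptyI finite_insert)
qed

text \<open>The scan starts on the left end marker and so counts one more than the length. The last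
  \<open>Tick\<close> raises the result to the base of the power N, which is thus at least
  2.\<close>

definition set_len :: "reg com" where
  "set_len = Seq (While (Inp (- {Right_End})) (Seq (Tick Len) Forward)) (Tick Len)"

lemma exec_set_len:
  assumes "length x + 2 \<le> B" "s Len = 0"
  shows "exec x B set_len s 0 [] (s(Len := length x + 2)) (length x + 1)"
proof -
  have "exec x B (While (Inp (- {Right_End})) (Seq (Tick Len) Forward)) (s(Len := v)) v []
      (s(Len := length x + 1)) (length x + 1)" if "v \<le> length x + 1" for v
    using that
  proof (induction rule: inc_induct)
    case base
    show ?case
      by (auto intro!: exec.While exec.Cond intro: exec.Emit simp: input_at_def)
  next
    case (step v)
    have "exec x B (Tick Len) (s(Len := v)) v [] (s(Len := Suc v)) v"
      using exec.Tick[of "s(Len := v)" Len B x v] step assms(1) by simp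
    moreover have "exec x B Forward (s(Len := Suc v)) v [] (s(Len := Suc v)) (Suc v)"
      using exec.Forward[of x B "s(Len := Suc v)" v] step(2) by simp
    ultimately have "exec x B (Seq (Seq (Tick Len) Forward) (While (Inp (- {Right_End})) (Seq (Tick Len) Forward)))
        (s(Len := v)) v (([] @ []) @ []) (s(Len := length x + 1)) (length x + 1)"
      using step.IH by (intro exec.Seq)
    then show ?case
      using step(2) by (intro exec.While exec.Cond) (auto simp: input_at_def fun_upd_def)
  qed
  moreover have "exec x B (Tick Len) (s(Len := length x + 1)) (length x + 1) []
      (s(Len := length x + 2)) (length x + 1)"
    using exec.Tick[of "s(Len := length x + 1)" Len B x "length x + 1"] assms by simp
  ultimately have "exec x B set_len (s(Len := 0)) 0 ([] @ []) (s(Len := length x + 2)) (length x + 1)"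
    unfolding set_len_def by (intro exec.Seq) auto
  then show ?thesis
    using assms by (simp add: fun_upd_idem)
qed

text \<open>\<open>Num\<close> bounds the outer loop and must stay fixed during it, so the product
  is collected in \<open>Col_Time\<close> and then moved back.\<close>

definition multiply :: "reg com" where
  "multiply = Seq (for_loop Row_Time Num (for_loop Row_Pos Len (Tick Col_Time)))
     (Seq (Zero Num) (Seq (for_loop Row_Pos Col_Time (Tick Num)) (Zero Col_Time)))"

lemma exec_multiply:
  assumes "s Num * s Len \<le> B" "s Num \<le> B" "s Row_Time = 0" "s Row_Pos = 0" "s Col_Time = 0"
  shows "exec x B multiply s h [] (s(Num := s Num * s Len)) h"
proof -
  have "exec x B (for_loop Row_Pos Len (Tick Col_Time)) (s(Col_Time := v * s Len, Row_Time := v)) h []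
      (s(Col_Time := Suc v * s Len, Row_Time := v)) h" if "v < s Num" for v
  proof -
    have "Suc v * s Len \<le> s Num * s Len"
      using that by (intro mult_right_mono) auto
    then show ?thesis
      using exec_for_loop_tick[of Row_Pos Len Col_Time "s(Col_Time := v * s Len, Row_Time := v)" B x h] assms
      by (simp add: fun_upd_twist algebra_simps)
  qed
  then have "exec x B (for_loop Row_Time Num (for_loop Row_Pos Len (Tick Col_Time)))
      (s(Col_Time := 0 * s Len)) h (concat (map (\<lambda>_. []) [0..<s Num]))
      (s(Col_Time := s Num * s Len, Row_Time := 0)) h"
    using assms
    by (intro exec_for_loop[where S = "\<lambda>v. s(Col_Time := v * s Len)" and H = "\<lambda>_. h"]) auto
  then have 1: "exec x B (for_loop Row_Time Num (for_loop Row_Pos Len (Tick Col_Time))) s h []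
      (s(Col_Time := s Num * s Len)) h"
    using assms by (simp add: concat_map_Nil fun_upd_idem fun_upd_twist)
  have 2: "exec x B (Zero Num) (s(Col_Time := s Num * s Len)) h [] (s(Col_Time := s Num * s Len, Num := 0)) h"
    by (rule exec.Zero)
  have 3: "exec x B (for_loop Row_Pos Col_Time (Tick Num)) (s(Col_Time := s Num * s Len, Num := 0)) h []
      (s(Col_Time := s Num * s Len, Num := s Num * s Len)) h"
    using exec_for_loop_tick[of Row_Pos Col_Time Num "s(Col_Time := s Num * s Len, Num := 0)" B x h] assms
    by simp
  have "exec x B (Zero Col_Time) (s(Col_Time := s Num * s Len, Num := s Num * s Len)) h []
      (s(Num := s Num * s Len)) h"
    using exec.Zero[of x B Col_Time "s(Col_Time := s Num * s Len, Num := s Num * s Len)" h] assms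
    by (simp add: fun_upd_idem fun_upd_twist)
  from exec.Seq[OF 1 exec.Seq[OF 2 exec.Seq[OF 3 this]]] show ?thesis
    by (simp add: multiply_def)
qed

primrec multiply_iter :: "nat \<Rightarrow> reg com" where
  "multiply_iter 0 = Emit []"
| "multiply_iter (Suc k) = Seq multiply (multiply_iter k)"

lemma exec_multiply_iter:
  assumes "s Num * s Len ^ k \<le> B" "0 < s Len" "s Row_Time = 0" "s Row_Pos = 0" "s Col_Time = 0"
  shows "exec x B (multiply_iter k) s h [] (s(Num := s Num * s Len ^ k)) h"
  using assms
proof (induction k arbitrary: s)
  case 0
  then show ?case by (simp add: exec.Emit)
next
  case (Suc k)
  have "s Num \<le> s Num * s Len" "s Num * s Len \<le> s Num * s Len * s Len ^ k"
    using Suc.prems(2) by simp_all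
  moreover have "s Num * s Len * s Len ^ k \<le> B"
    using Suc.prems(1) by (simp add: algebra_simps)
  ultimately have "s Num \<le> B" "s Num * s Len \<le> B"
    by linarith+
  then have "exec x B multiply s h [] (s(Num := s Num * s Len)) h"
    using Suc.prems by (intro exec_multiply) auto
  moreover have "exec x B (multiply_iter k) (s(Num := s Num * s Len)) h [] (s(Num := s Num * s Len ^ Suc k)) h"
    using Suc.IH[of "s(Num := s Num * s Len)"] Suc.prems
    by (simp add: algebra_simps fun_upd_def cong: if_cong)
  ultimately have "exec x B (Seq multiply (multiply_iter k)) s h ([] @ []) (s(Num := s Num * s Len ^ Suc k)) h"
    by (rule exec.Seq)
  then show ?case
    by (simp add: fun_upd_def)
qed

definition prelude :: "nat \<Rightarrow> reg com" where
  "prelude k = Seq set_len (Seq (Tick Num) (Seq (multiply_iter k)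
     (Seq (for_loop Row_Time Num (Tick Suc_Num)) (Tick Suc_Num))))"

definition ready :: "nat \<Rightarrow> nat \<Rightarrow> reg \<Rightarrow> nat" where
  "ready n k = (\<lambda>_. 0)(Len := n + 2, Num := (n + 2) ^ k, Suc_Num := Suc ((n + 2) ^ k))"

lemma exec_prelude:
  assumes "B = (length x + 2) ^ k + 1" "0 < k"
  shows "exec x B (prelude k) (\<lambda>_. 0) 0 [] (ready (length x) k) (length x + 1)"
proof -
  define n h where "n = length x" and "h = length x + 1"
  have le: "n + 2 \<le> B"
    using self_le_power[of "n + 2" k] assms by (simp add: n_def)
  have 1: "exec x B set_len (\<lambda>_. 0) 0 [] ((\<lambda>_. 0)(Len := n + 2)) h"
    using exec_set_len[of x B "\<lambda>_. 0"] le by (simp add: n_def h_def)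
  have 2: "exec x B (Tick Num) ((\<lambda>_. 0)(Len := n + 2)) h [] ((\<lambda>_. 0)(Len := n + 2, Num := 1)) h"
    using exec.Tick[of "(\<lambda>_. 0)(Len := n + 2)" Num B x h] le by simp
  have 3: "exec x B (multiply_iter k) ((\<lambda>_. 0)(Len := n + 2, Num := 1)) h []
      ((\<lambda>_. 0)(Len := n + 2, Num := (n + 2) ^ k)) h"
    using exec_multiply_iter[of "(\<lambda>_. 0)(Len := n + 2, Num := 1)" k B x h] assms by (simp add: n_def)
  have 4: "exec x B (for_loop Row_Time Num (Tick Suc_Num)) ((\<lambda>_. 0)(Len := n + 2, Num := (n + 2) ^ k)) h []
      ((\<lambda>_. 0)(Len := n + 2, Num := (n + 2) ^ k, Suc_Num := (n + 2) ^ k)) h"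
    using exec_for_loop_tick[of Row_Time Num Suc_Num "(\<lambda>_. 0)(Len := n + 2, Num := (n + 2) ^ k)" B x h] assms
    by (simp add: n_def)
  have 5: "exec x B (Tick Suc_Num) ((\<lambda>_. 0)(Len := n + 2, Num := (n + 2) ^ k, Suc_Num := (n + 2) ^ k)) h []
      (ready n k) h"
    using exec.Tick[of "(\<lambda>_. 0)(Len := n + 2, Num := (n + 2) ^ k, Suc_Num := (n + 2) ^ k)" Suc_Num B x h] assms
    by (simp add: n_def ready_def)
  from exec.Seq[OF 1 exec.Seq[OF 2 exec.Seq[OF 3 exec.Seq[OF 4 5]]]] show ?thesis
    by (simp add: prelude_def n_def h_def)
qed

section \<open>The formula in Polish notation\<close>

abbreviation imp_code :: "bool list" where
  "imp_code \<equiv> [True, False, False]"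

lemma enc_fm_below:
  "enc_fm (below j) = concat (replicate j (imp_code @ enc_fm verum)) @ enc_fm no_endpoint"
  by (induction j) simp_all

text \<open>The implications are nested to the left, so all their symbols come first and the
  conclusions follow by increasing index, a form that plain loops can print.\<close>

lemma enc_fm_nor_fm:
  "enc_fm (nor_fm i) = concat (replicate i imp_code) @ enc_fm all_endpoints @
     concat (map (\<lambda>j. enc_fm (below j)) [0..<i])"
  by (induction i) (simp_all del: nor_fm.simps(1) add: nor_fm.simps(1))

text \<open>The formula has 2 * N rounds, but counters only go up to N + 1. Loops therefore run N
  times and print two items per pass.\<close>

lemma concat_replicate_double: "concat (replicate (2 * n) w) = concat (map (\<lambda>_. w @ w) [0..<n])"
proof (induction n)
  case (Suc n)
  have "replicate (2 * Suc n) w = replicate (2 * n) w @ [w, w]"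
    using replicate_add[of "2 * n" 2 w] by (simp add: numeral_2_eq_2)
  then show ?case
    by (simp only: concat_append Suc.IH) simp
qed simp

lemma concat_map_double:
  "concat (map f [0..<2 * n]) = concat (map (\<lambda>j. f (2 * j) @ f (Suc (2 * j))) [0..<n])"
  by (induction n) simp_all

lemma concat_map_concat: "concat (map f (concat xss)) = concat (map (\<lambda>xs. concat (map f xs)) xss)"
  by (induction xss) simp_all

lemma concat_map_replicate: "concat (map (\<lambda>_. replicate b y) [0..<a]) = replicate (a * b) y"
  by (induction a) (simp_all add: replicate_add[symmetric] add.commute)

definition print_formula :: "reg com" where
  "print_formula =
    (let pad = for_loop Col_Time Row_Time
        (Emit ((imp_code @ enc_fm verum) @ (imp_code @ enc_fm verum)))
     in Seq (for_loop Row_Time Num (Emit (imp_code @ imp_code)))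
       (Seq (Emit (enc_fm all_endpoints))
         (for_loop Row_Time Num
           (Seq (Seq pad (Emit (enc_fm no_endpoint)))
             (Seq pad (Emit (imp_code @ enc_fm verum @ enc_fm no_endpoint)))))))"

lemma exec_print_formula:
  assumes "s Num \<le> B" "s Row_Time = 0" "s Col_Time = 0"
  shows "exec x B print_formula s h (enc_fm (nor_fm (2 * s Num))) s h"
proof -
  define pad where "pad = for_loop Col_Time Row_Time
    (Emit ((imp_code @ enc_fm verum) @ (imp_code @ enc_fm verum)))"
  define even where "even j = concat (replicate (2 * j) (imp_code @ enc_fm verum))" for j
  have pad: "exec x B pad (s(Row_Time := j)) h (even j) (s(Row_Time := j)) h" if "j < s Num" for j
    using exec_for_loop_const_head[of Col_Time Row_Time "s(Row_Time := j)" B x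
        "Emit ((imp_code @ enc_fm verum) @ (imp_code @ enc_fm verum))" h
        "\<lambda>_. (imp_code @ enc_fm verum) @ (imp_code @ enc_fm verum)"] that assms
    unfolding pad_def even_def concat_replicate_double by (simp add: exec.Emit)
  have 1: "exec x B (for_loop Row_Time Num (Emit (imp_code @ imp_code))) s h
      (concat (map (\<lambda>_. imp_code @ imp_code) [0..<s Num])) s h"
    using assms by (intro exec_for_loop_const_head) (auto intro: exec.Emit)
  have 2: "exec x B (for_loop Row_Time Num
         (Seq (Seq pad (Emit (enc_fm no_endpoint)))
           (Seq pad (Emit (imp_code @ enc_fm verum @ enc_fm no_endpoint))))) s h
      (concat (map (\<lambda>j. (even j @ enc_fm no_endpoint) @ even j @ imp_code @ enc_fm verum @ enc_fm no_endpoint)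
        [0..<s Num])) s h"
    using assms pad by (intro exec_for_loop_const_head exec.Seq) (auto intro: exec.Emit)
  have below: "enc_fm (below (2 * j)) = even j @ enc_fm no_endpoint"
    "enc_fm (below (Suc (2 * j))) = even j @ imp_code @ enc_fm verum @ enc_fm no_endpoint" for j
  proof -
    show "enc_fm (below (2 * j)) = even j @ enc_fm no_endpoint"
      by (simp only: enc_fm_below even_def)
    have "replicate (Suc (2 * j)) w = replicate (2 * j) w @ [w]" for w :: "bool list"
      by (simp add: replicate_append_same)
    then show "enc_fm (below (Suc (2 * j))) = even j @ imp_code @ enc_fm verum @ enc_fm no_endpoint"
      by (simp only: enc_fm_below even_def) simp
  qed
  have "exec x B print_formula s h (concat (map (\<lambda>_. imp_code @ imp_code) [0..<s Num]) @ enc_fm all_endpoints @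
      concat (map (\<lambda>j. (even j @ enc_fm no_endpoint) @ even j @ imp_code @ enc_fm verum @ enc_fm no_endpoint)
        [0..<s Num])) s h"
    unfolding print_formula_def Let_def using 1 2 exec.Emit
    by (intro exec.Seq) (auto simp: pad_def)
  also have "concat (map (\<lambda>_. imp_code @ imp_code) [0..<s Num]) @ enc_fm all_endpoints @
      concat (map (\<lambda>j. (even j @ enc_fm no_endpoint) @ even j @ imp_code @ enc_fm verum @ enc_fm no_endpoint)
        [0..<s Num]) = enc_fm (nor_fm (2 * s Num))"
    unfolding enc_fm_nor_fm concat_replicate_double concat_map_double below by simp
  finally show ?thesis .
qed

section \<open>Numbering the nodes\<close>

definition nodes :: "gate list \<Rightarrow> nat \<Rightarrow> node list" where
  "nodes gs N = concat (map (\<lambda>p. concat (map (\<lambda>i. map (\<lambda>g. (p, i, g)) gs) [0..<Suc N])) [0..<Suc N])"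

lemma length_rows:
  "length (concat (map (\<lambda>p. concat (map (\<lambda>i. map (\<lambda>g. (p, i, g)) gs) [0..<b])) [0..<a])) = a * (b * length gs)"
proof -
  have "length (concat (map (\<lambda>i. map (\<lambda>g. (p, i, g)) gs) [0..<b])) = b * length gs" for p :: nat
    by (induction b) simp_all
  then show ?thesis
    by (induction a) simp_all
qed

lemma length_nodes: "length (nodes gs N) = Suc N * (Suc N * length gs)"
  unfolding nodes_def by (rule length_rows)

lemma set_nodes: "set (nodes gs N) = {..N} \<times> {..N} \<times> set gs"
proof -
  have "set (nodes gs N) = (\<Union>p\<in>{..N}. \<Union>i\<in>{..N}. (\<lambda>g. (p, i, g)) ` set gs)"
    by (simp add: nodes_def atLeast0LessThan lessThan_Suc_atMost del: upt_Suc)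
  also have "\<dots> = {..N} \<times> {..N} \<times> set gs"
    by blast
  finally show ?thesis .
qed

text \<open>The first gate of the list opens the block of each position. The queried world thus has
  a product as its number, which nested loops can print in unary.\<close>

lemma nth_nodes: "nodes (g # gs) N ! (N * (Suc N * length (g # gs))) = (N, 0, g)"
proof -
  have "nodes (g # gs) N =
     concat (map (\<lambda>p. concat (map (\<lambda>i. map (\<lambda>g. (p, i, g)) (g # gs)) [0..<Suc N])) [0..<N]) @
     concat (map (\<lambda>i. map (\<lambda>g. (N, i, g)) (g # gs)) [0..<Suc N])"
  proof -
    have "concat (map F [0..<Suc N]) = concat (map F [0..<N]) @ F N" for F :: "nat \<Rightarrow> node list"
      by simp
    then show ?thesis unfolding nodes_def .
  qed
  moreover have "concat (map (\<lambda>i. map (\<lambda>g. (N, i, g)) (g # gs)) [0..<Suc N]) ! 0 = (N, 0, g)"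
    by (simp add: upt_conv_Cons del: upt_Suc)
  ultimately show ?thesis
    using length_rows[of "g # gs" "Suc N" N] by (metis add.right_neutral nth_append_length_plus)
qed

definition node_model :: "tm \<Rightarrow> bool list \<Rightarrow> nat \<Rightarrow> node list \<Rightarrow> nat model" where
  "node_model T x N ws = \<lparr>worlds = {..<length ws},
     acc = {(u, v). u < length ws \<and> v < length ws \<and> edge T x N (ws ! u) (ws ! v)},
     valuation = (\<lambda>_. {})\<rparr>"

lemma enc_matrix_node_model:
  "enc_matrix (length ws) (length ws) (\<lambda>u v. (u, v) \<in> acc (node_model T x N ws)) =
     concat (map (\<lambda>w. map (edge T x N w) ws) ws)"
proof -
  have "enc_matrix (length ws) (length ws) (\<lambda>u v. (u, v) \<in> acc (node_model T x N ws)) =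
     concat (map (\<lambda>u. map (\<lambda>v. edge T x N (ws ! u) (ws ! v)) [0..<length ws]) [0..<length ws])"
    unfolding enc_matrix_def
    by (intro arg_cong[where f = concat] map_cong) (auto simp: node_model_def)
  also have "\<dots> = concat (map (\<lambda>w. map (edge T x N w) (map ((!) ws) [0..<length ws])) (map ((!) ws) [0..<length ws]))"
    by (simp add: comp_def)
  finally show ?thesis
    by (simp only: map_nth)
qed

definition print_unary :: "nat \<Rightarrow> reg \<Rightarrow> reg com" where
  "print_unary K m = Seq (for_loop Row_Time m (for_loop Row_Pos Suc_Num (Emit (replicate K True)))) (Emit [False])"

lemma exec_print_unary:
  assumes "m = Num \<or> m = Suc_Num" "s m \<le> B" "s Suc_Num \<le> B" "s Row_Time = 0" "s Row_Pos = 0"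
  shows "exec x B (print_unary K m) s h (enc_nat (s m * (s Suc_Num * K))) s h"
proof -
  have "exec x B (for_loop Row_Pos Suc_Num (Emit (replicate K True))) (s(Row_Time := v)) h
      (replicate (s Suc_Num * K) True) (s(Row_Time := v)) h" for v
    using exec_for_loop_const_head[of Row_Pos Suc_Num "s(Row_Time := v)" B x "Emit (replicate K True)" h
      "\<lambda>_. replicate K True"] assms by (simp add: concat_map_replicate exec.Emit)
  then have "exec x B (for_loop Row_Time m (for_loop Row_Pos Suc_Num (Emit (replicate K True)))) s h
      (concat (map (\<lambda>_. replicate (s Suc_Num * K) True) [0..<s m])) s h"
    using assms by (intro exec_for_loop_const_head) auto
  then show ?thesis
    unfolding print_unary_def enc_nat_def concat_map_replicate by (intro exec.Seq) (auto intro: exec.Emit)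
qed

text \<open>
  An entry of the adjacency matrix depends on the indices of the row and of the column only
  through the outcome of the following comparisons.
\<close>

definition tests :: "reg test list" where
  "tests = [Less True Col_Time Row_Time, Less False Col_Time Row_Time, Less False Row_Time Col_Time,
     Less False Null Row_Time, Less False Col_Pos Row_Pos, Less True Col_Pos Row_Pos,
     Less False Row_Pos Col_Pos, Less True Row_Pos Col_Pos, Less False Row_Pos Num,
     Less False Null Row_Pos, Inp {Bit True}, Inp {Bit False}]"

definition entry :: "tm \<Rightarrow> gate \<Rightarrow> bool list \<Rightarrow> gate \<Rightarrow> bool" where
  "entry T g bs = (let far = bs ! 0; less = bs ! 1; greater = bs ! 2; later = bs ! 3;
       left = bs ! 4; far_left = bs ! 5; right = bs ! 6; far_right = bs ! 7;
       inner = bs ! 8; pos = bs ! 9; one = bs ! 10; zero = bs ! 11;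
       here = \<not> left \<and> \<not> right
     in wire T (if pos then None else Some (tm_start T), if one then 2 else if zero then 1 else 0)
       far (less \<and> \<not> far) (\<not> less \<and> \<not> greater) (\<not> later)
       (if pos then left \<and> \<not> far_left else here) here (if inner then right \<and> \<not> far_right else here) g)"

text \<open>The left end marker shifts the symbol of cell i to head position i + 1. Beyond the input
  the head rests on the right end marker, where both bit tests fail; this stands for the blank. At
  the borders, where a cell is its own neighbour, adjacency is replaced by equality.\<close>

lemma entry_tests:
  assumes "s Null = 0" "s Row_Pos \<le> s Num" "h = min (Suc (s Row_Pos)) (length x + 1)"
  shows "entry T g (map (holds x s h) tests) g' \<longleftrightarrow>
    edge T x (s Num) (s Row_Time, s Row_Pos, g) (s Col_Time, s Col_Pos, g')"
proof -
  have "cell_at (tm_init T x) (s Row_Pos) = (if 0 < s Row_Pos then None else Some (tm_start T),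
      if input_at x h = Bit True then 2 else if input_at x h = Bit False then 1 else 0)"
    using assms by (auto simp: cell_at_def tm_init_def input_at_def min_def)
  moreover have "s Col_Pos = s Row_Pos - 1 \<longleftrightarrow>
      (if 0 < s Row_Pos then s Col_Pos < s Row_Pos \<and> \<not> s Col_Pos + 1 < s Row_Pos else s Col_Pos = s Row_Pos)"
    by auto
  moreover have "s Col_Pos = min (Suc (s Row_Pos)) (s Num) \<longleftrightarrow>
      (if s Row_Pos < s Num then s Row_Pos < s Col_Pos \<and> \<not> s Row_Pos + 1 < s Col_Pos else s Col_Pos = s Row_Pos)"
    using assms by auto
  moreover have "Suc (s Col_Time) = s Row_Time \<longleftrightarrow>
      s Col_Time < s Row_Time \<and> \<not> s Col_Time + 1 < s Row_Time"
    "s Col_Time = s Row_Time \<longleftrightarrow> \<not> s Col_Time < s Row_Time \<and> \<not> s Row_Time < s Col_Time"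
    "s Col_Pos = s Row_Pos \<longleftrightarrow> \<not> s Col_Pos < s Row_Pos \<and> \<not> s Row_Pos < s Col_Pos"
    by auto
  ultimately show ?thesis
    unfolding edge_def case_prod_conv
    by (simp add: entry_def tests_def assms(1) Let_def)
qed

text \<open>A complete decision tree: the program doubles with every test, but its size is
  independent of the input.\<close>

primrec branch :: "'r test list \<Rightarrow> (bool list \<Rightarrow> bool list) \<Rightarrow> 'r com" where
  "branch [] F = Emit (F [])"
| "branch (t # ts) F = Cond t (branch ts (\<lambda>bs. F (True # bs))) (branch ts (\<lambda>bs. F (False # bs)))"

lemma exec_branch: "exec x B (branch ts F) s h (F (map (holds x s h) ts)) s h"
proof (induction ts arbitrary: F)
  case Nil
  then show ?case by (simp add: exec.Emit)
next
  case (Cons t ts)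
  show ?case
    using Cons[of "\<lambda>bs. F (True # bs)"] Cons[of "\<lambda>bs. F (False # bs)"]
    by (auto intro!: exec.Cond)
qed

definition print_row :: "tm \<Rightarrow> gate list \<Rightarrow> gate \<Rightarrow> reg com" where
  "print_row T gs g = for_loop Col_Time Suc_Num (for_loop Col_Pos Suc_Num
     (branch tests (\<lambda>bs. map (entry T g bs) gs)))"

primrec print_rows :: "tm \<Rightarrow> gate list \<Rightarrow> gate list \<Rightarrow> reg com" where
  "print_rows T gs [] = Emit []"
| "print_rows T gs (g # hs) = Seq (print_row T gs g) (print_rows T gs hs)"

text \<open>The input head moves along with \<open>Row_Pos\<close> and is brought back for every
  value of \<open>Row_Time\<close>, so that it always shows the initial content of the cell of the
  row.\<close>

definition print_matrix :: "tm \<Rightarrow> gate list \<Rightarrow> reg com" where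
  "print_matrix T gs = for_loop Row_Time Suc_Num (Seq (Seq Rewind Forward)
     (for_loop Row_Pos Suc_Num (Seq (print_rows T gs gs) Forward)))"

lemma exec_print_row:
  assumes "s Null = 0" "s Col_Time = 0" "s Col_Pos = 0" "s Suc_Num \<le> B" "s Suc_Num = Suc (s Num)"
    "s Row_Pos \<le> s Num" "h = min (Suc (s Row_Pos)) (length x + 1)"
  shows "exec x B (print_row T gs g) s h
    (map (edge T x (s Num) (s Row_Time, s Row_Pos, g)) (nodes gs (s Num))) s h"
proof -
  have branch: "exec x B (branch tests (\<lambda>bs. map (entry T g bs) gs)) (s(Col_Time := p, Col_Pos := i)) h
      (map (\<lambda>g'. edge T x (s Num) (s Row_Time, s Row_Pos, g) (p, i, g')) gs)
      (s(Col_Time := p, Col_Pos := i)) h" for p i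
  proof -
    have "entry T g (map (holds x (s(Col_Time := p, Col_Pos := i)) h) tests) =
        (\<lambda>g'. edge T x (s Num) (s Row_Time, s Row_Pos, g) (p, i, g'))"
      using entry_tests[of "s(Col_Time := p, Col_Pos := i)" h x T g] assms by (intro ext) simp
    then show ?thesis
      using exec_branch[of x B tests "\<lambda>bs. map (entry T g bs) gs" "s(Col_Time := p, Col_Pos := i)" h]
      by simp
  qed
  have "exec x B (for_loop Col_Pos Suc_Num (branch tests (\<lambda>bs. map (entry T g bs) gs))) (s(Col_Time := p)) h
      (concat (map (\<lambda>i. map (\<lambda>g'. edge T x (s Num) (s Row_Time, s Row_Pos, g) (p, i, g')) gs)
        [0..<s Suc_Num])) (s(Col_Time := p)) h" for p
    using exec_for_loop_const_head[of Col_Pos Suc_Num "s(Col_Time := p)" B x _ h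
      "\<lambda>i. map (\<lambda>g'. edge T x (s Num) (s Row_Time, s Row_Pos, g) (p, i, g')) gs"] branch assms(3,4)
    by simp
  then have "exec x B (print_row T gs g) s h
      (concat (map (\<lambda>p. concat (map (\<lambda>i. map (\<lambda>g'. edge T x (s Num) (s Row_Time, s Row_Pos, g) (p, i, g')) gs)
        [0..<s Suc_Num])) [0..<s Suc_Num])) s h"
    unfolding print_row_def using assms by (intro exec_for_loop_const_head) auto
  then show ?thesis
    by (simp add: nodes_def map_concat comp_def assms(5) del: upt_Suc)
qed

lemma exec_print_rows:
  assumes "s Null = 0" "s Col_Time = 0" "s Col_Pos = 0" "s Suc_Num \<le> B" "s Suc_Num = Suc (s Num)"
    "s Row_Pos \<le> s Num" "h = min (Suc (s Row_Pos)) (length x + 1)"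
  shows "exec x B (print_rows T gs hs) s h
    (concat (map (\<lambda>g. map (edge T x (s Num) (s Row_Time, s Row_Pos, g)) (nodes gs (s Num))) hs)) s h"
proof (induction hs)
  case Nil
  then show ?case by (simp add: exec.Emit)
next
  case (Cons g hs)
  then show ?case
    using exec.Seq[OF exec_print_row[OF assms] Cons] by simp
qed

lemma exec_print_matrix:
  assumes "s Null = 0" "s Col_Time = 0" "s Col_Pos = 0" "s Row_Time = 0" "s Row_Pos = 0"
    "s Suc_Num \<le> B" "s Suc_Num = Suc (s Num)"
  shows "\<exists>h'. exec x B (print_matrix T gs) s h
    (concat (map (\<lambda>w. map (edge T x (s Num) w) (nodes gs (s Num))) (nodes gs (s Num)))) s h'"
proof -
  define hd where "hd i = min (Suc i) (length x + 1)" for i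
  have row: "exec x B (Seq (print_rows T gs gs) Forward) (s(Row_Time := p, Row_Pos := i)) (hd i)
      (concat (map (\<lambda>g. map (edge T x (s Num) (p, i, g)) (nodes gs (s Num))) gs))
      (s(Row_Time := p, Row_Pos := i)) (hd (Suc i))" if "i < s Suc_Num" for p i
  proof -
    have "exec x B Forward (s(Row_Time := p, Row_Pos := i)) (hd i) []
        (s(Row_Time := p, Row_Pos := i)) (hd (Suc i))"
      using exec.Forward[of x B "s(Row_Time := p, Row_Pos := i)" "hd i"]
      by (auto simp: hd_def min_def split: if_splits)
    from exec.Seq[OF exec_print_rows this] show ?thesis
      using assms that by (auto simp: hd_def)
  qed
  have start: "exec x B (Seq Rewind Forward) s h [] s (hd 0)" for s h
    using exec.Seq[OF exec.Rewind exec.Forward, of x B s h] by (simp add: hd_def)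
  have "exec x B (for_loop Row_Pos Suc_Num (Seq (print_rows T gs gs) Forward)) (s(Row_Time := p)) (hd 0)
      (concat (map (\<lambda>i. concat (map (\<lambda>g. map (edge T x (s Num) (p, i, g)) (nodes gs (s Num))) gs)) [0..<s Suc_Num]))
      (s(Row_Time := p)) (hd (s Suc_Num))" for p
    using exec_for_loop_const[of Row_Pos Suc_Num "s(Row_Time := p)" B x _ hd
      "\<lambda>i. concat (map (\<lambda>g. map (edge T x (s Num) (p, i, g)) (nodes gs (s Num))) gs)"] row assms(5,6)
    by simp
  from exec.Seq[OF start this]
  have "exec x B (Seq (Seq Rewind Forward) (for_loop Row_Pos Suc_Num (Seq (print_rows T gs gs) Forward)))
      (s(Row_Time := p)) h
      (concat (map (\<lambda>i. concat (map (\<lambda>g. map (edge T x (s Num) (p, i, g)) (nodes gs (s Num))) gs)) [0..<s Suc_Num]))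
      (s(Row_Time := p)) (hd (s Suc_Num))" for p h
    by simp
  \<comment> \<open>The first pass finds the head at an arbitrary \<open>h\<close>, every later one
    where its predecessor stopped. The conditionals are the end values of one function covering both
    cases.\<close>
  then have "exec x B (print_matrix T gs) s (if (0::nat) = 0 then h else hd (s Suc_Num))
      (concat (map (\<lambda>p. concat (map (\<lambda>i. concat (map (\<lambda>g. map (edge T x (s Num) (p, i, g)) (nodes gs (s Num))) gs))
        [0..<s Suc_Num])) [0..<s Suc_Num])) s (if s Suc_Num = 0 then h else hd (s Suc_Num))"
    unfolding print_matrix_def using assms
    by (intro exec_for_loop_const[where H = "\<lambda>v. if v = 0 then h else hd (s Suc_Num)"]) auto
  moreover have "concat (map (\<lambda>w. map (edge T x (s Num) w) ws) (nodes gs (s Num))) =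
      concat (map (\<lambda>p. concat (map (\<lambda>i. concat (map (\<lambda>g. map (edge T x (s Num) (p, i, g)) ws) gs))
        [0..<s Suc_Num])) [0..<s Suc_Num])" for ws
    by (simp add: nodes_def assms(7) concat_map_concat comp_def del: upt_Suc)
  ultimately show ?thesis
    by auto
qed

text \<open>The lone \<open>False\<close> is the code of 0, the number of variables; the matrix of
  the valuation is then empty.\<close>

definition print_instance :: "nat \<Rightarrow> tm \<Rightarrow> gate list \<Rightarrow> reg com" where
  "print_instance k T gs = Seq (prelude k) (Seq print_formula (Seq (print_unary (length gs) Suc_Num)
     (Seq (print_matrix T gs) (Seq (Emit [False]) (print_unary (length gs) Num)))))"

lemma exec_print_instance:
  fixes x :: "bool list" and k :: nat
  defines "N \<equiv> (length x + 2) ^ k"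
  assumes "0 < k"
  shows "\<exists>s h. exec x (N + 1) (print_instance k T gs) (\<lambda>_. 0) 0
    (enc_instance (nor_fm (2 * N)) (length (nodes gs N)) 0 (node_model T x N (nodes gs N))
      (N * (Suc N * length gs))) s h"
proof -
  define s where "s = ready (length x) k"
  have s: "s Num = N" "s Suc_Num = Suc N" "s Row_Time = 0" "s Col_Time = 0" "s Row_Pos = 0"
    "s Col_Pos = 0" "s Null = 0"
    by (simp_all add: s_def ready_def N_def)
  obtain h where h: "exec x (N + 1) (print_matrix T gs) s (length x + 1)
      (concat (map (\<lambda>w. map (edge T x N w) (nodes gs N)) (nodes gs N))) s h"
    using exec_print_matrix[of s "N + 1" x T gs "length x + 1"] s by auto
  have "exec x (N + 1) (prelude k) (\<lambda>_. 0) 0 [] s (length x + 1)"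
    unfolding s_def N_def using assms by (intro exec_prelude) auto
  moreover have "exec x (N + 1) print_formula s (length x + 1) (enc_fm (nor_fm (2 * N))) s (length x + 1)"
    using exec_print_formula[of s "N + 1" x "length x + 1"] s by simp
  moreover have "exec x (N + 1) (print_unary (length gs) Suc_Num) s (length x + 1)
      (enc_nat (length (nodes gs N))) s (length x + 1)"
    using exec_print_unary[of Suc_Num s "N + 1" x "length gs" "length x + 1"] s by (simp add: length_nodes)
  moreover have "exec x (N + 1) (print_unary (length gs) Num) s h (enc_nat (N * (Suc N * length gs))) s h"
    using exec_print_unary[of Num s "N + 1" x "length gs" h] s by simp
  moreover have "exec x (N + 1) (Emit [False]) s h [False] s h"
    by (rule exec.Emit)
  ultimately have "exec x (N + 1) (print_instance k T gs) (\<lambda>_. 0) 0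
      ([] @ enc_fm (nor_fm (2 * N)) @ enc_nat (length (nodes gs N)) @
        concat (map (\<lambda>w. map (edge T x N w) (nodes gs N)) (nodes gs N)) @ [False] @
        enc_nat (N * (Suc N * length gs))) s h"
    unfolding print_instance_def using h by (intro exec.Seq)
  moreover have "enc_matrix 0 n Q = []" for n Q
    by (simp add: enc_matrix_def)
  moreover have "enc_nat 0 = [False]"
    by (simp add: enc_nat_def)
  ultimately show ?thesis
    unfolding enc_instance_def enc_model_def enc_matrix_node_model by auto
qed

section \<open>The reduction\<close>

lemma codes_node_model:
  assumes "ws \<noteq> []"
  shows "codes_model (length ws) 0 (node_model T x N ws)"
  using assms unfolding codes_model_def bpl_model_def
  by (auto simp: node_model_def intro!: transI dest: trans_edge)

lemma sat_node_model:
  assumes "set ws = worlds (circuit T x N)" "u < length ws" "var_free \<phi>"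
  shows "sat (node_model T x N ws) u \<phi> \<longleftrightarrow> sat (circuit T x N) (ws ! u) \<phi>"
proof (rule sat_bounded_morphism)
  have ws: "v \<in> {..N} \<times> {..N} \<times> gates T \<longleftrightarrow> (\<exists>i<length ws. ws ! i = v)" for v
    using assms(1) in_set_conv_nth[of v ws] by (simp add: circuit_def)
  show "(ws ! u, ws ! v) \<in> acc (circuit T x N)" if "(u, v) \<in> acc (node_model T x N ws)" for u v
    using that ws[of "ws ! u"] ws[of "ws ! v"] by (auto simp: node_model_def circuit_def)
  show "\<exists>v. (u, v) \<in> acc (node_model T x N ws) \<and> ws ! v = v'"
    if "u \<in> worlds (node_model T x N ws)" "(ws ! u, v') \<in> acc (circuit T x N)" for u v'
    using that ws[of v'] by (auto simp: node_model_def circuit_def)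
qed (use assms in \<open>auto simp: node_model_def\<close>)

lemma tm_run_halted:
  assumes "tm_halted T (tm_run T x t)" "t \<le> t'"
  shows "tm_run T x t' = tm_run T x t"
  using assms(2)
proof (induction rule: dec_induct)
  case (step t')
  then show ?case using assms(1) by (simp add: tm_run_def tm_step_def)
qed simp

text \<open>A pure power of \<open>n + 2\<close> is what iterated multiplication computes. As the
  base is at least 2, the exponent c + 1 absorbs the factor 2 * c.\<close>

lemma polynomial_le_power: "c * n ^ k + c \<le> (n + 2) ^ (k + c + 1)" for n :: nat
proof -
  have "c * n ^ k + c \<le> c * (n + 2) ^ k + c * (n + 2) ^ k"
    by (intro add_mono mult_left_mono power_mono) auto
  also have "\<dots> = (2 * c) * (n + 2) ^ k"
    by simp
  also have "2 * c \<le> 2 ^ (c + 1)"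
    using less_exp[of c] by simp
  also have "(2::nat) ^ (c + 1) \<le> (n + 2) ^ (c + 1)"
    by (intro power_mono) auto
  finally show ?thesis
    by (simp add: power_add algebra_simps)
qed

theorem theorem3p5: "P_hard BPL0_MC"
  unfolding P_hard_def
proof
  fix A
  assume "A \<in> class_P"
  then obtain T c k where T: "wf_tm T" and dec: "decides_in_time T A (\<lambda>n. c * n ^ k + c)"
    unfolding class_P_def by blast
  have fin: "finite (gates T)"
    using T by (auto simp: gates_def cells_def wf_tm_def)
  then obtain gs' where "set gs' = gates T"
    using finite_list[OF fin] by auto
  \<comment> \<open>\<open>Top\<close> is put in front so that the queried world gets a known
    number. It occurs in \<open>gs'\<close> as well, so some nodes are numbered twice.\<close>
  then have gs: "set (Top # gs') = gates T"
    by (simp add: insert_absorb in_gates)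
  define gs where "gs = Top # gs'"
  define N where "N x = (length x + 2) ^ (k + c + 1)" for x :: "bool list"
  define ws where "ws x = nodes gs (N x)" for x
  define M where "M x = node_model T x (N x) (ws x)" for x
  define s where "s x = N x * (Suc (N x) * length gs)" for x
  define f where "f x = enc_instance (nor_fm (2 * N x)) (length (ws x)) 0 (M x) (s x)" for x
  have "logspace_computable f"
  proof (rule logspace_computable_exec)
    show "\<exists>s h. exec x ((length x + 2) ^ (k + c + 1) + 1) (print_instance (k + c + 1) T gs)
        (\<lambda>_. 0) 0 (f x) s h" for x
      using exec_print_instance[of "k + c + 1" x T gs] by (simp add: f_def M_def s_def ws_def N_def)
  qed
  moreover have "x \<in> A \<longleftrightarrow> f x \<in> BPL0_MC" for x
  proof -
    define t where "t = c * length x ^ k + c"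
    have halted: "tm_halted T (tm_run T x t)" and A: "x \<in> A \<longleftrightarrow> cstate (tm_run T x t) = tm_accept T"
      using dec unfolding decides_in_time_def t_def by blast+
    have "tm_run T x (N x) = tm_run T x t"
      using polynomial_le_power[of c "length x" k] by (intro tm_run_halted[OF halted]) (simp add: t_def N_def)
    \<comment> \<open>The machine has halted and its two halting states differ, so accepting means
      not rejecting, which is the value of \<open>Top\<close>.\<close>
    then have "x \<in> A \<longleftrightarrow> cstate (tm_run T x (N x)) \<noteq> tm_reject T"
      using A halted T by (auto simp: tm_halted_def wf_tm_def)
    also have "\<dots> \<longleftrightarrow> sat (circuit T x (N x)) (N x, 0, Top) (nor_fm (2 * N x))"
      by (rule sat_Top[OF T, symmetric]) (simp add: N_def)
    also have "(N x, 0, Top) = ws x ! s x"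
      by (simp only: ws_def s_def gs_def nth_nodes)
    also have s: "s x < length (ws x)"
      by (simp add: s_def ws_def length_nodes gs_def)
    then have "sat (circuit T x (N x)) (ws x ! s x) (nor_fm (2 * N x)) \<longleftrightarrow> sat (M x) (s x) (nor_fm (2 * N x))"
      unfolding M_def using gs
      by (intro sat_node_model[symmetric]) (auto simp: ws_def set_nodes gs_def circuit_def var_free_nor_fm)
    finally have sat: "x \<in> A \<longleftrightarrow> sat (M x) (s x) (nor_fm (2 * N x))" .
    have codes: "codes_model (length (ws x)) 0 (M x)"
      unfolding M_def using s by (intro codes_node_model) auto
    have "s x \<in> worlds (M x)"
      using s by (simp add: M_def node_model_def)
    \<comment> \<open>A code of a negative instance could belong to the language only as the code of
      another, positive instance; injectivity of the encoding excludes this.\<close>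
    then show ?thesis
      using sat codes var_free_nor_fm enc_instance_inj[OF _ codes]
      unfolding f_def BPL0_MC_def by blast
  qed
  ultimately show "logspace_reducible A BPL0_MC"
    unfolding logspace_reducible_def by blast
qed

end
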